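(* Let $0<p\le 1$ and $\alpha>-1$, and let $\mu$ be a positive Borel measure on $[0,1)$ which is a $\frac{2}{p}$-Carleson measure. Then the following hold. (a) If $\alpha>1$, then $\mathcal{H}_{\mu}^{\alpha}:A^{p}\to A^{1}$ is bounded if and only if $\mu$ is a $\left(\frac{2}{p}+\alpha-1\right)$-Carleson measure. (b) If $-1<\alpha<1$, then $\mathcal{H}_{\mu}^{\alpha}:A^{p}\to A^{1}$ is bounded if and only if $\mu$ is a $\frac{2}{p}$-Carleson measure.
   Context: $\mathbb{D}$ is the open unit disk in $\mathbb{C}$, $H(\mathbb{D})$ is the space of analytic functions on $\mathbb{D}$, and $dA=\frac{dx\,dy}{\pi}$. For $0<p<\infty$, the Bergman space $A^{p}$ consists of all $f\in H(\mathbb{D})$ with $\|f\|_{A^{p}}=\left(\int_{\mathbb{D}}|f(z)|^{p}dA(z)\right)^{1/p}<\infty$. For $s>0$, a positive Borel measure $\mu$ on $[0,1)$ is an $s$-Carleson measure if there is $M>0$ with $\mu([t,1))\le M(1-t)^{s}$ for all $0\le t<1$. Put $\mu_{n}=\int_{[0,1)}t^{n}d\mu(t)$ and $\mu_{n,k}=\mu_{n+k}$ for $n,k\ge 0$. For $\alpha>-1$ and $f(z)=\sum_{k=0}^{\infty}a_{k}z^{k}\in H(\mathbb{D})$, define $$\mathcal{H}_{\mu}^{\alpha}(f)(z)=\sum_{n=0}^{\infty}\frac{\Gamma(n+1+\alpha)}{\Gamma(n+1)\Gamma(\alpha+1)}\left(\sum_{k=0}^{\infty}\mu_{n,k}a_{k}\right)z^{n},\quad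 z\in\mathbb{D},$$ whenever the inner series converge and the power series converges in $\mathbb{D}$. That $\mathcal{H}_{\mu}^{\alpha}:X\to Y$ is bounded means that $\mathcal{H}_\mu^\alpha(f)$ is well defined in this sense and belongs to $Y$ for every $f\in X$, and there is $C>0$ with $\|\mathcal{H}_{\mu}^{\alpha}(f)\|_{Y}\le C\|f\|_{X}$ for all $f\in X$. *)

theory Defs
  imports "HOL-Complex_Analysis.Complex_Analysis"
begin

definition disk_area :: "complex measure" where
  "disk_area = scale_measure (ennreal (1 / pi)) (restrict_space lborel (ball 0 1))"

text \<open>
  Members of \<open>bergman p\<close> are total functions on \<^typ>\<open>complex\<close>; only their values
  on the open unit disk are constrained, and only these enter \<open>bergman_norm\<close>
  (which is just a quasi-norm for \<open>p < 1\<close>).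
\<close>

definition bergman :: "real \<Rightarrow> (complex \<Rightarrow> complex) set" where
  "bergman p = {f. f holomorphic_on ball 0 1 \<and> integrable disk_area (\<lambda>z. cmod (f z) powr p)}"

definition bergman_norm :: "real \<Rightarrow> (complex \<Rightarrow> complex) \<Rightarrow> real" where
  "bergman_norm p f = (LINT z|disk_area. cmod (f z) powr p) powr (1 / p)"

text \<open>
  A positive Borel measure on \<open>[0,1)\<close> is a \<^typ>\<open>real measure\<close> whose
  \<open>\<sigma>\<close>-algebra is the Borel one on \<open>{0..<1}\<close>; it need not be finite a priori.
\<close>

definition borel_measure_Ico01 :: "real measure \<Rightarrow> bool" where
  "borel_measure_Ico01 \<mu> \<longleftrightarrow> sets \<mu> = sets (restrict_space borel {0..<1})"

definition carleson :: "real \<Rightarrow> real measure \<Rightarrow> bool" where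
  "carleson s \<mu> \<longleftrightarrow>
     (\<exists>M>0. \<forall>t. 0 \<le> t \<and> t < 1 \<longrightarrow> emeasure \<mu> {t..<1} \<le> ennreal (M * (1 - t) powr s))"

text \<open>
  The Bochner integral below is the intended moment for finite \<open>\<mu>\<close>; an
  \<open>s\<close>-Carleson measure is finite (take \<open>t = 0\<close>).
\<close>

definition moment :: "real measure \<Rightarrow> nat \<Rightarrow> real" where
  "moment \<mu> n = (LINT t|\<mu>. t ^ n)"

definition taylor_coeff :: "(complex \<Rightarrow> complex) \<Rightarrow> nat \<Rightarrow> complex" where
  "taylor_coeff f k = fps_nth (fps_expansion f 0) k"

definition hilbert_coeff :: "real measure \<Rightarrow> real \<Rightarrow> (complex \<Rightarrow> complex) \<Rightarrow> nat \<Rightarrow> complex" where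
  "hilbert_coeff \<mu> \<alpha> f n =
     of_real (Gamma (real n + 1 + \<alpha>) / (Gamma (real n + 1) * Gamma (\<alpha> + 1))) *
     (\<Sum>k. of_real (moment \<mu> (n + k)) * taylor_coeff f k)"

definition hilbert_op :: "real measure \<Rightarrow> real \<Rightarrow> (complex \<Rightarrow> complex) \<Rightarrow> complex \<Rightarrow> complex" where
  "hilbert_op \<mu> \<alpha> f z = (\<Sum>n. hilbert_coeff \<mu> \<alpha> f n * z ^ n)"

definition hilbert_op_defined :: "real measure \<Rightarrow> real \<Rightarrow> (complex \<Rightarrow> complex) \<Rightarrow> bool" where
  "hilbert_op_defined \<mu> \<alpha> f \<longleftrightarrow>
     (\<forall>n. summable (\<lambda>k. of_real (moment \<mu> (n + k)) * taylor_coeff f k)) \<and>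
     (\<forall>z\<in>ball 0 1. summable (\<lambda>n. hilbert_coeff \<mu> \<alpha> f n * z ^ n))"

definition hilbert_op_bounded :: "real measure \<Rightarrow> real \<Rightarrow> real \<Rightarrow> real \<Rightarrow> bool" where
  "hilbert_op_bounded \<mu> \<alpha> p q \<longleftrightarrow>
     (\<forall>f\<in>bergman p. hilbert_op_defined \<mu> \<alpha> f \<and> hilbert_op \<mu> \<alpha> f \<in> bergman q) \<and>
     (\<exists>C>0. \<forall>f\<in>bergman p. bergman_norm q (hilbert_op \<mu> \<alpha> f) \<le> C * bergman_norm p f)"

end

theory Submission
  imports Defs
begin

text \<open>
  Write \<open>a k\<close> for the Taylor coefficients of \<open>f\<close> and
  \<open>\<H>f\<close> for the image of \<open>f\<close> under the operator. Formally,
  \<open>\<H>f(z) = \<integral> f(t) (1 - t z) powr (- (\<alpha> + 1)) d\<mu>(t)\<close>,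
  because the weights \<open>\<Gamma>(n + 1 + \<alpha>) / (\<Gamma>(n + 1) \<Gamma>(\<alpha> +
  1))\<close> are the Taylor coefficients of \<open>(1 - x) powr (- (\<alpha> + 1))\<close> and
  \<open>\<Sum>k. \<mu>(n + k) a k = \<integral> t ^ n f(t) d\<mu>(t)\<close>. Everything rests
  on making this formula rigorous and on two estimates for \<open>f\<close> in the Bergman
  space.

  The first is the growth bound \<open>|f(z)| \<le> C (1 - |z|) powr (- 2 / p)
  \<parallel>f\<parallel>\<close> (\<open>bergman_growth\<close>). For \<open>p < 1\<close> it
  is derived from the area mean value inequality for \<open>|f|\<close>, instead of
  subharmonicity of \<open>|f| powr p\<close>: at a point that maximizes \<open>|f(w)| (R - |w|)
  powr (2 / p)\<close>, the factor \<open>|f| powr (1 - p)\<close> in \<open>|f| = |f| powr p *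
  |f| powr (1 - p)\<close> is controlled by the maximum itself.

  The second is \<open>\<Sum>k. |a k| (k + 2) powr (- 2 / p) \<le> C
  \<parallel>f\<parallel>\<close> (\<open>bergman_coeff_sum\<close>). Each \<open>a k\<close> is
  estimated by the integral of \<open>|f|\<close> over an annulus at distance about \<open>1 /
  k\<close> from the circle. The annuli are disjoint, so after \<open>|f|\<close> has been
  traded for \<open>|f| powr p\<close> by the growth bound, the estimates add up. Since the
  moments of a \<open>2 / p\<close>-Carleson measure \<open>\<nu>\<close> are \<open>O(k powr (-
  2 / p))\<close>, the second estimate makes \<open>\<Sum>k. \<nu>(n + k) a k\<close> absolutely
  convergent, and at the same time gives the Carleson embedding \<open>\<integral> |f(t)|
  d\<nu>(t) \<le> C \<parallel>f\<parallel>\<close>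
  (\<open>nn_integral_carleson_embedding\<close>).

  For sufficiency, Tonelli bounds the \<open>A\<^sup>1\<close> norm of \<open>\<H>f\<close> by
  \<open>\<integral> |f(t)| J(t) d\<mu>(t)\<close>, where \<open>J(t)\<close> is the area
  integral of \<open>|1 - t z| powr (- (\<alpha> + 1))\<close> over the disk. If \<open>\<alpha>
  < 1\<close>, \<open>J\<close> is bounded and the embedding applies to \<open>\<mu>\<close>. If
  \<open>\<alpha> > 1\<close>, \<open>J(t)\<close> is at most a multiple of \<open>(1 - t) powr
  (1 - \<alpha>)\<close>, and the embedding applies to \<open>(1 - t) powr (1 - \<alpha>)
  d\<mu>(t)\<close>, which is \<open>2 / p\<close>-Carleson when \<open>\<mu>\<close> is
  \<open>(2 / p + \<alpha> - 1)\<close>-Carleson.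

  For necessity, test on \<open>f(z) = 1 / (1 - a z) ^ n\<close> with \<open>n p > 2\<close>,
  whose norm is at most a multiple of \<open>(1 - a) powr (2 / p - n)\<close>. All integrands
  are positive at \<open>z = a\<close>, so \<open>\<H>f(a)\<close> is at least a multiple of
  \<open>\<mu>([a,1)) (1 - a) powr (- (n + \<alpha> + 1))\<close>; the growth bound with
  \<open>p = 1\<close> gives \<open>|\<H>f(a)| \<le> C (1 - a) powr (- 2)
  \<parallel>\<H>f\<parallel>\<close>. Comparing the two yields the Carleson condition.
\<close>

section \<open>Rotation invariance of Lebesgue measure on the plane\<close>

lemma measurable_Complex [measurable]:
  "(\<lambda>(x, y). Complex x y) \<in> borel_measurable (borel \<Otimes>\<^sub>M borel)"
proof -
  have "continuous_on UNIV (\<lambda>(x, y). Complex x y)"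
    unfolding Complex_eq case_prod_unfold by (intro continuous_intros)
  from borel_measurable_continuous_onI[OF this] show ?thesis
    by (simp add: borel_prod)
qed

lemma lborel_complex_eq_distr:
  "lborel = distr (lborel \<Otimes>\<^sub>M lborel) borel (\<lambda>(x, y). Complex x y)"
proof (rule lborel_eqI)
  fix l u :: complex
  assume le: "\<And>b. b \<in> Basis \<Longrightarrow> l \<bullet> b \<le> u \<bullet> b"
  have [measurable]: "(\<lambda>(x, y). Complex x y) \<in> borel_measurable (lborel \<Otimes>\<^sub>M lborel)"
    using measurable_Complex
    by (subst measurable_cong_sets[OF sets_pair_measure_cong[OF sets_lborel sets_lborel] refl])
  have "(\<lambda>(x, y). Complex x y) -` box l u \<inter> space (lborel \<Otimes>\<^sub>M lborel)
      = {Re l<..<Re u} \<times> {Im l<..<Im u}"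
    by (auto simp: box_Complex_eq space_pair_measure mem_box Basis_complex_def)
  then have "emeasure (distr (lborel \<Otimes>\<^sub>M lborel) borel (\<lambda>(x, y). Complex x y)) (box l u)
     = emeasure (lborel \<Otimes>\<^sub>M lborel) ({Re l<..<Re u} \<times> {Im l<..<Im u})"
    by (subst emeasure_distr) auto
  also have "\<dots> = ennreal (Re u - Re l) * ennreal (Im u - Im l)"
    using le[of 1] le[of "\<i>"]
    by (subst lborel.emeasure_pair_measure_Times) (auto simp: Basis_complex_def)
  also have "\<dots> = (\<Prod>b\<in>Basis. (u - l) \<bullet> b)"
    using le[of 1] le[of "\<i>"] by (simp add: Basis_complex_def ennreal_mult)
  finally show "emeasure (distr (lborel \<Otimes>\<^sub>M lborel) borel (\<lambda>(x, y). Complex x y)) (box l u)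
    = (\<Prod>b\<in>Basis. (u - l) \<bullet> b)" .
qed simp

lemma nn_integral_complex_iterated:
  assumes [measurable]: "g \<in> borel_measurable borel"
  shows "(\<integral>\<^sup>+z. g z \<partial>lborel) = (\<integral>\<^sup>+x. \<integral>\<^sup>+y. g (Complex x y) \<partial>lborel \<partial>lborel)"
    and "(\<integral>\<^sup>+z. g z \<partial>lborel) = (\<integral>\<^sup>+y. \<integral>\<^sup>+x. g (Complex x y) \<partial>lborel \<partial>lborel)"
proof -
  have m [measurable]: "(\<lambda>(x, y). Complex x y) \<in> borel_measurable (lborel \<Otimes>\<^sub>M lborel)"
    using measurable_Complex
    by (subst measurable_cong_sets[OF sets_pair_measure_cong[OF sets_lborel sets_lborel] refl])
  have m': "(\<lambda>(x, y). g (Complex x y)) \<in> borel_measurable (lborel \<Otimes>\<^sub>M lborel)"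
    using measurable_compose[OF m assms] by (simp add: case_prod_unfold)
  have eq: "(\<integral>\<^sup>+z. g z \<partial>lborel)
      = (\<integral>\<^sup>+w. (case w of (x, y) \<Rightarrow> g (Complex x y)) \<partial>(lborel \<Otimes>\<^sub>M lborel))"
    by (subst lborel_complex_eq_distr, subst nn_integral_distr) (auto simp: case_prod_unfold)
  show "(\<integral>\<^sup>+z. g z \<partial>lborel) = (\<integral>\<^sup>+x. \<integral>\<^sup>+y. g (Complex x y) \<partial>lborel \<partial>lborel)"
    using lborel.nn_integral_fst[OF m'] eq by simp
  show "(\<integral>\<^sup>+z. g z \<partial>lborel) = (\<integral>\<^sup>+y. \<integral>\<^sup>+x. g (Complex x y) \<partial>lborel \<partial>lborel)"
    using lborel_pair.nn_integral_snd[OF m'] eq by simp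
qed

text \<open>
  By Tonelli: for each fixed value of one coordinate, a shear is a translation in the other one.
\<close>

lemma nn_integral_shear:
  assumes [measurable]: "g \<in> borel_measurable borel"
  shows "(\<integral>\<^sup>+z. g (Complex (Re z + a * Im z) (Im z)) \<partial>lborel) = (\<integral>\<^sup>+z. g z \<partial>lborel)"
    and "(\<integral>\<^sup>+z. g (Complex (Re z) (Im z + a * Re z)) \<partial>lborel) = (\<integral>\<^sup>+z. g z \<partial>lborel)"
proof -
  have tr: "(\<integral>\<^sup>+x. h (x + t) \<partial>lborel) = (\<integral>\<^sup>+x. h x \<partial>lborel)"
    if "h \<in> borel_measurable borel" for h :: "real \<Rightarrow> ennreal" and t
    using nn_integral_real_affine[OF that, of 1 t] by (simp add: add.commute)
  have mC: "(\<lambda>z. g (Complex (p z) (q z))) \<in> borel_measurable borel"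
    if "p \<in> borel_measurable borel" "q \<in> borel_measurable borel"
    for p q :: "'b::topological_space \<Rightarrow> real"
    using measurable_compose[OF measurable_compose[OF measurable_Pair[OF that] measurable_Complex] assms]
    by simp
  have "(\<integral>\<^sup>+z. g (Complex (Re z + a * Im z) (Im z)) \<partial>lborel)
      = (\<integral>\<^sup>+y. \<integral>\<^sup>+x. g (Complex (x + a * y) y) \<partial>lborel \<partial>lborel)"
    by (subst nn_integral_complex_iterated(2)) (auto intro!: mC)
  also have "\<dots> = (\<integral>\<^sup>+y. \<integral>\<^sup>+x. g (Complex x y) \<partial>lborel \<partial>lborel)"
    by (subst tr) (auto intro!: mC)
  finally show "(\<integral>\<^sup>+z. g (Complex (Re z + a * Im z) (Im z)) \<partial>lborel) = (\<integral>\<^sup>+z. g z \<partial>lborel)"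
    using nn_integral_complex_iterated(2)[OF assms] by simp
  have "(\<integral>\<^sup>+z. g (Complex (Re z) (Im z + a * Re z)) \<partial>lborel)
      = (\<integral>\<^sup>+x. \<integral>\<^sup>+y. g (Complex x (y + a * x)) \<partial>lborel \<partial>lborel)"
    by (subst nn_integral_complex_iterated(1)) (auto intro!: mC)
  also have "\<dots> = (\<integral>\<^sup>+x. \<integral>\<^sup>+y. g (Complex x y) \<partial>lborel \<partial>lborel)"
    by (subst tr) (auto intro!: mC)
  finally show "(\<integral>\<^sup>+z. g (Complex (Re z) (Im z + a * Re z)) \<partial>lborel) = (\<integral>\<^sup>+z. g z \<partial>lborel)"
    using nn_integral_complex_iterated(1)[OF assms] by simp
qed

text \<open>
  A rotation other than the half turn is a product of three shears, in the real, the imaginary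
  and again the real direction; the shear factors are \<open>- tan (\<theta> / 2)\<close>,
  \<open>sin \<theta>\<close>, \<open>- tan (\<theta> / 2)\<close> for the angle
  \<open>\<theta>\<close>.
\<close>

lemma nn_integral_rotate_ne_minus_one:
  fixes u :: complex
  assumes [measurable]: "g \<in> borel_measurable borel" and u: "norm u = 1" "u \<noteq> -1"
  shows "(\<integral>\<^sup>+z. g (u * z) \<partial>lborel) = (\<integral>\<^sup>+z. g z \<partial>lborel)"
proof -
  define a b where "a = - Im u / (1 + Re u)" and "b = Im u"
  have sq: "(Re u)\<^sup>2 + (Im u)\<^sup>2 = 1"
    using u cmod_power2[of u] by simp
  have nz: "1 + Re u \<noteq> 0"
  proof
    assume "1 + Re u = 0"
    then have "Re u = -1" by simp
    with sq have "Im u = 0" by simp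
    with \<open>Re u = -1\<close> u(2) show False by (simp add: complex_eq_iff)
  qed
  define T where "T = (\<lambda>z. Complex (Re z + a * Im z) (Im z))"
  define S where "S = (\<lambda>z. Complex (Re z) (Im z + b * Re z))"
  have ab: "a * b = Re u - 1"
    using nz sq by (simp add: a_def b_def field_simps power2_eq_square)
  have ab2: "2 * a + a * a * b = - Im u"
  proof -
    have "2 * a + a * a * b = a * (2 + a * b)" by (simp add: algebra_simps)
    also have "\<dots> = a * (1 + Re u)" using ab by simp
    also have "\<dots> = - Im u" using nz by (simp add: a_def)
    finally show ?thesis .
  qed
  \<comment> \<open>the matrix product of the three shears, simplified with \<open>1 + a b = Re u\<close> and
    \<open>2 a + a\<^sup>2 b = - Im u\<close>\<close>
  have TST: "T (S (T z)) = u * z" for z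
  proof -
    have "Re (T (S (T z))) = (1 + a * b) * Re z + (2 * a + a * a * b) * Im z"
      by (simp add: T_def S_def algebra_simps)
    moreover have "Im (T (S (T z))) = b * Re z + (1 + a * b) * Im z"
      by (simp add: T_def S_def algebra_simps)
    moreover have "1 + a * b = Re u" using ab by simp
    ultimately show ?thesis
      unfolding ab2 by (simp add: complex_eq_iff b_def)
  qed
  have [measurable]: "T \<in> borel_measurable borel" "S \<in> borel_measurable borel"
    unfolding T_def S_def Complex_eq
    by (intro borel_measurable_continuous_onI continuous_intros)+
  have "(\<integral>\<^sup>+z. g (u * z) \<partial>lborel) = (\<integral>\<^sup>+z. g (T (S (T z))) \<partial>lborel)" by (simp add: TST)
  also have "\<dots> = (\<integral>\<^sup>+z. g (T (S z)) \<partial>lborel)"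
    using nn_integral_shear(1)[of "\<lambda>z. g (T (S z))" a] by (simp add: T_def)
  also have "\<dots> = (\<integral>\<^sup>+z. g (T z) \<partial>lborel)"
    using nn_integral_shear(2)[of "\<lambda>z. g (T z)" b] by (simp add: S_def)
  also have "\<dots> = (\<integral>\<^sup>+z. g z \<partial>lborel)"
    using nn_integral_shear(1)[of g a] by (simp add: T_def)
  finally show ?thesis .
qed

text \<open>
  Every unit number is the square of its principal square root, which is never
  \<open>-1\<close>, so that the half turn is covered by rotating twice.
\<close>

lemma lborel_distr_rotate:
  assumes u: "norm u = 1"
  shows "distr lborel borel (\<lambda>z. u * z) = (lborel :: complex measure)"
proof (rule measure_eqI)
  fix A :: "complex set" assume "A \<in> sets (distr lborel borel (\<lambda>z. u * z))"
  then have A [measurable]: "A \<in> sets borel" by simp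
  have m [measurable]: "(\<lambda>z. u * z) \<in> borel_measurable borel"
    by (intro borel_measurable_continuous_onI continuous_intros)
  define v where "v = csqrt u"
  have "v * v = u" unfolding v_def using power2_csqrt[of u] by (simp add: power2_eq_square)
  have "norm v = 1" using u \<open>v * v = u\<close>
    by (metis abs_norm_cancel norm_mult power2_eq_1_iff power2_eq_square abs_1 abs_minus)
  have "v \<noteq> -1"
  proof
    assume "v = -1"
    with \<open>v * v = u\<close> have "u = 1" by simp
    with \<open>v = -1\<close> show False by (simp add: v_def)
  qed
  have "emeasure (distr lborel borel (\<lambda>z. u * z)) A = (\<integral>\<^sup>+z. indicator A (v * (v * z)) \<partial>lborel)"
    using nn_integral_distr[of "\<lambda>z. u * z" lborel borel "indicator A"]
    by (simp add: mult.assoc[symmetric] \<open>v * v = u\<close>)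
  also have "\<dots> = (\<integral>\<^sup>+z. indicator A (v * z) \<partial>lborel)"
    using nn_integral_rotate_ne_minus_one[of "\<lambda>z. indicator A (v * z)" v] \<open>norm v = 1\<close> \<open>v \<noteq> -1\<close> by simp
  also have "\<dots> = (\<integral>\<^sup>+z. indicator A z \<partial>lborel)"
    using nn_integral_rotate_ne_minus_one[of "indicator A" v] \<open>norm v = 1\<close> \<open>v \<noteq> -1\<close> by simp
  finally show "emeasure (distr lborel borel (\<lambda>z. u * z)) A = emeasure lborel A" by simp
qed simp

section \<open>Area integrals of holomorphic functions over annuli\<close>

lemma borel_annulus [measurable]: "{w::complex. r \<le> norm w \<and> norm w < R} \<in> sets borel"
  by measurable

lemma measure_annulus:
  assumes "0 \<le> r" "r \<le> R"
  shows "measure lborel {w::complex. r \<le> norm w \<and> norm w < R} = pi * (R\<^sup>2 - r\<^sup>2)"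
proof -
  have "{w::complex. r \<le> norm w \<and> norm w < R} = ball 0 R - ball 0 r" by auto
  also have "measure lborel (ball 0 R - ball (0::complex) r)
      = measure lborel (ball (0::complex) R) - measure lborel (ball (0::complex) r)"
    using assms emeasure_lborel_ball_finite[of "0::complex" R]
    by (intro measure_Diff) (auto simp: top.not_eq_extremum)
  also have "\<dots> = pi * (R\<^sup>2 - r\<^sup>2)"
    using assms by (simp add: content_ball unit_ball_vol_2 algebra_simps)
  finally show ?thesis .
qed

lemma integral_rotation_covariant_eq_0:
  fixes h :: "complex \<Rightarrow> complex"
  assumes [measurable]: "h \<in> borel_measurable borel" and u: "norm u = 1" and "c \<noteq> 1"
    and cov: "\<And>w. h (u * w) = c * h w"
  shows "(LINT w|lborel. h w) = 0"
proof -
  have [measurable]: "(\<lambda>z. u * z) \<in> borel_measurable borel"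
    by (intro borel_measurable_continuous_onI continuous_intros)
  have "(LINT w|lborel. h w) = (LINT w|distr lborel borel (\<lambda>z. u * z). h w)"
    by (simp add: lborel_distr_rotate[OF u])
  also have "\<dots> = c * (LINT w|lborel. h w)"
    by (subst integral_distr) (auto simp: cov)
  finally have "(1 - c) * (LINT w|lborel. h w) = 0" by (simp add: algebra_simps)
  with \<open>c \<noteq> 1\<close> show ?thesis by simp
qed

text \<open>
  Rotation by the angle \<open>\<pi> / (j - k)\<close> changes the sign of the integrand. This
  replaces integration in polar coordinates.
\<close>

lemma integral_annulus_monomials_orthogonal:
  assumes "j \<noteq> k"
  shows "(LINT w:{w. r \<le> norm w \<and> norm w < R}|lborel. w ^ j * cnj w ^ k) = 0"
  unfolding set_lebesgue_integral_def
proof (rule integral_rotation_covariant_eq_0)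
  define \<theta> where "\<theta> = pi / (real j - real k)"
  have "real j * \<theta> - real k * \<theta> = (real j - real k) * \<theta>"
    by (simp add: algebra_simps)
  also have "\<dots> = pi" using assms by (simp add: \<theta>_def)
  finally have jk: "real j * \<theta> - real k * \<theta> = pi" .
  have "cis \<theta> ^ j * cnj (cis \<theta>) ^ k = cis (real j * \<theta>) * cis (- (real k * \<theta>))"
    by (simp only: Complex.DeMoivre cis_cnj mult_minus_right)
  also have "\<dots> = cis (real j * \<theta> - real k * \<theta>)" by (simp add: cis_mult)
  also have "\<dots> = -1" using jk by simp
  finally have c: "cis \<theta> ^ j * cnj (cis \<theta>) ^ k = -1" .
  show "norm (cis \<theta>) = 1" by simp
  show "cis \<theta> ^ j * cnj (cis \<theta>) ^ k \<noteq> 1" by (simp add: c)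
  show "indicator {w. r \<le> norm w \<and> norm w < R} (cis \<theta> * w) *\<^sub>R ((cis \<theta> * w) ^ j * cnj (cis \<theta> * w) ^ k)
    = cis \<theta> ^ j * cnj (cis \<theta>) ^ k *
      (indicator {w. r \<le> norm w \<and> norm w < R} w *\<^sub>R (w ^ j * cnj w ^ k))" for w
    by (auto simp: indicator_def norm_mult power_mult_distrib)
  have [measurable]: "(\<lambda>w. w ^ j * cnj w ^ k) \<in> borel_measurable borel"
    by (intro borel_measurable_continuous_onI continuous_intros)
  show "(\<lambda>w. indicator {w. r \<le> norm w \<and> norm w < R} w *\<^sub>R (w ^ j * cnj w ^ k)) \<in> borel_measurable borel"
    by measurable
qed

lemma set_integrable_annulus:
  fixes h :: "complex \<Rightarrow> 'b::{banach, second_countable_topology}"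
  assumes "continuous_on (cball 0 R) h"
  shows "set_integrable lborel {w. r \<le> norm w \<and> norm w < R} h"
proof (rule set_integrable_subset)
  show "set_integrable lborel (cball 0 R) h"
    unfolding set_integrable_def
    by (rule borel_integrable_compact) (use assms in auto)
qed (auto simp: borel_annulus)

text \<open>
  Integrating the Taylor series against \<open>cnj w ^ k\<close> over the annulus isolates the
  \<open>k\<close>-th coefficient, multiplied by the integral of \<open>|w| ^ (2 * k)\<close>,
  which is at least \<open>r ^ (2 * k)\<close> times the area.
\<close>

lemma annulus_coeff_bound:
  assumes holf: "f holomorphic_on ball 0 \<rho>" and r: "0 \<le> r" "r \<le> R" "R < \<rho>" "R \<le> 1"
  shows "norm ((deriv ^^ k) f 0 / fact k) * (r ^ (2 * k) * (pi * (R\<^sup>2 - r\<^sup>2)))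
     \<le> (LINT w:{w. r \<le> norm w \<and> norm w < R}|lborel. norm (f w))"
proof -
  define A where "A = {w::complex. r \<le> norm w \<and> norm w < R}"
  have [measurable]: "A \<in> sets borel" unfolding A_def by measurable
  have "emeasure lborel A \<le> emeasure lborel (ball (0::complex) R)"
    by (intro emeasure_mono) (auto simp: A_def)
  then have finA: "emeasure lborel A < \<infinity>"
    using emeasure_lborel_ball_finite by (rule le_less_trans)
  define a where "a = (\<lambda>j. (deriv ^^ j) f 0 / fact j)"
  have sums: "(\<lambda>j. a j * w ^ j) sums f w" if "norm w < \<rho>" for w
    using holomorphic_power_series[OF holf, of w] that by (simp add: a_def)
  have "0 \<le> R" using r by linarith
  \<comment> \<open>convergence at the larger radius \<open>R'\<close> gives absolute convergence at
    \<open>R\<close>\<close>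
  define R' where "R' = (R + \<rho>) / 2"
  have absum: "summable (\<lambda>j. norm (a j) * R ^ j)"
  proof -
    have "summable (\<lambda>j. a j * of_real R' ^ j)"
      using r \<open>0 \<le> R\<close> by (intro sums_summable[OF sums]) (simp add: R'_def flip: of_real_add)
    from powser_insidea[OF this, of "of_real R"] show ?thesis
      using r \<open>0 \<le> R\<close> by (simp add: R'_def norm_mult norm_power flip: of_real_add)
  qed
  have cont: "continuous_on (cball 0 R) f"
    using holf r by (intro holomorphic_on_imp_continuous_on) (auto elim: holomorphic_on_subset)
  define h where "h = (\<lambda>j w. indicator A w *\<^sub>R (a j * (w ^ j * cnj w ^ k)))"
  have int_mon: "set_integrable lborel A (\<lambda>w. w ^ j * cnj w ^ k)" for j
    unfolding A_def by (rule set_integrable_annulus) (intro continuous_intros)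
  have inth: "integrable lborel (h j)" for j
    using set_integrable_mult_right[of "a j", OF int_mon[of j]]
    unfolding h_def set_integrable_def by simp
  have nh: "norm (h j w) \<le> (norm (a j) * R ^ j) * indicator A w" for j w
  proof (cases "w \<in> A")
    case True
    then have "norm w \<le> R" by (simp add: A_def)
    then have "norm w ^ j * norm w ^ k \<le> R ^ j * 1"
      using r \<open>0 \<le> R\<close> by (intro mult_mono power_mono power_le_one) auto
    then show ?thesis using True
      by (simp add: h_def norm_mult norm_power mult_left_mono)
  qed (simp add: h_def)
  have "(\<lambda>j. LINT w|lborel. h j w) sums (LINT w|lborel. (\<Sum>j. h j w))"
  proof (rule sums_integral[OF inth])
    show "AE w in lborel. summable (\<lambda>j. norm (h j w))"
      by (intro AE_I2 summable_comparison_test'[OF summable_mult2[OF absum]])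
         (use nh in auto)
    show "summable (\<lambda>j. LINT w|lborel. norm (h j w))"
    proof (rule summable_comparison_test'[OF summable_mult2[OF absum, of "measure lborel A"]])
      fix j
      have "(LINT w|lborel. norm (h j w)) \<le> (LINT w|lborel. (norm (a j) * R ^ j) * indicator A w)"
        using nh inth finA by (intro integral_mono integrable_norm) auto
      then show "norm (LINT w|lborel. norm (h j w)) \<le> norm (a j) * R ^ j * measure lborel A"
        by (simp add: integral_nonneg_AE)
    qed
  qed
  also have "(\<lambda>j. LINT w|lborel. h j w) = (\<lambda>j. if j = k then LINT w|lborel. h k w else 0)"
  proof
    fix j
    have "(LINT w|lborel. h j w) = a j * (LINT w:A|lborel. w ^ j * cnj w ^ k)"
      unfolding h_def set_lebesgue_integral_def by (subst integral_mult_right_zero[symmetric]) simp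
    then show "(LINT w|lborel. h j w) = (if j = k then LINT w|lborel. h k w else 0)"
      using integral_annulus_monomials_orthogonal[of j k r R] by (auto simp: A_def)
  qed
  finally have "(LINT w|lborel. h k w) = (LINT w|lborel. (\<Sum>j. h j w))"
    using sums_unique2[OF _ sums_single[of k "\<lambda>_. LINT w|lborel. h k w"]] by (metis (no_types, lifting))
  also have "(\<lambda>w. \<Sum>j. h j w) = (\<lambda>w. indicator A w *\<^sub>R (f w * cnj w ^ k))"
  proof
    fix w
    show "(\<Sum>j. h j w) = indicator A w *\<^sub>R (f w * cnj w ^ k)"
    proof (cases "w \<in> A")
      case True
      then have "(\<lambda>j. a j * w ^ j * cnj w ^ k) sums (f w * cnj w ^ k)"
        using r by (intro sums_mult2 sums) (simp add: A_def)
      then show ?thesis using True by (simp add: h_def sums_iff mult.assoc)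
    qed (simp add: h_def)
  qed
  finally have eq: "(LINT w|lborel. h k w) = (LINT w:A|lborel. f w * cnj w ^ k)"
    by (simp add: set_lebesgue_integral_def)
  have "r ^ (2 * k) * (pi * (R\<^sup>2 - r\<^sup>2)) = (LINT w:A|lborel. r ^ (2 * k))"
    using measure_annulus[of r R] r finA by (simp add: A_def set_lebesgue_integral_def)
  also have "\<dots> \<le> (LINT w:A|lborel. norm w ^ (2 * k))"
  proof (rule set_integral_mono)
    show "set_integrable lborel A (\<lambda>w. r ^ (2 * k))" "set_integrable lborel A (\<lambda>w. norm w ^ (2 * k))"
      unfolding A_def by (intro set_integrable_annulus continuous_intros)+
  qed (use r in \<open>auto simp: A_def intro!: power_mono\<close>)
  finally have "norm (a k) * (r ^ (2 * k) * (pi * (R\<^sup>2 - r\<^sup>2)))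
      \<le> norm (a k) * (LINT w:A|lborel. norm w ^ (2 * k))"
    by (simp add: mult_left_mono)
  also have "\<dots> = norm (LINT w|lborel. h k w)"
  proof -
    have cc: "w * cnj w = (of_real (norm w))\<^sup>2" for w
      by (metis complex_norm_square of_real_power)
    have "h k w = a k * of_real (indicator A w *\<^sub>R norm w ^ (2 * k))" for w
      by (simp add: h_def indicator_def power_mult cc power_mult_distrib[symmetric] scaleR_conv_of_real)
    then have "(LINT w|lborel. h k w) = a k * of_real (LINT w:A|lborel. norm w ^ (2 * k))"
      unfolding set_lebesgue_integral_def by (simp only: integral_mult_right_zero integral_complex_of_real)
    moreover have "0 \<le> (LINT w:A|lborel. norm w ^ (2 * k))"
      unfolding set_lebesgue_integral_def by (intro integral_nonneg_AE) auto
    ultimately show ?thesis by (simp add: norm_mult)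
  qed
  also have "\<dots> = norm (LINT w:A|lborel. f w * cnj w ^ k)" by (simp add: eq)
  also have "\<dots> \<le> (LINT w:A|lborel. norm (f w * cnj w ^ k))"
    unfolding A_def
    by (intro set_integral_norm_bound set_integrable_annulus continuous_intros cont)
  also have "\<dots> \<le> (LINT w:A|lborel. norm (f w))"
  proof (rule set_integral_mono)
    show "set_integrable lborel A (\<lambda>w. norm (f w * cnj w ^ k))"
      "set_integrable lborel A (\<lambda>w. norm (f w))"
      unfolding A_def by (intro set_integrable_annulus continuous_intros cont)+
    fix w assume "w \<in> A"
    then have "norm w ^ k \<le> 1" using r by (intro power_le_one) (auto simp: A_def)
    then show "norm (f w * cnj w ^ k) \<le> norm (f w)"
      by (simp add: norm_mult norm_power mult_left_le)
  qed
  finally show ?thesis by (simp add: a_def A_def)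
qed

text \<open>
  The case of the coefficient bound with \<open>k = 0\<close> and inner radius \<open>0\<close>,
  translated to the center \<open>c\<close>.
\<close>

lemma mean_value_ball:
  assumes holf: "f holomorphic_on ball c \<rho>" and r: "0 < r" "r < \<rho>" "r \<le> 1"
  shows "norm (f c) * (pi * r\<^sup>2) \<le> (LINT w:ball c r|lborel. norm (f w))"
proof -
  have "(\<lambda>w. f (c + w)) holomorphic_on ball 0 \<rho>"
  proof -
    have "(\<lambda>w. f (c + w)) = f \<circ> (\<lambda>w. c + w)" by auto
    moreover have "f \<circ> (\<lambda>w. c + w) holomorphic_on ball 0 \<rho>"
      using holf by (intro holomorphic_on_compose_gen[of _ _ _ "ball c \<rho>"] holomorphic_intros)
        (auto simp: dist_norm)
    ultimately show ?thesis by simp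
  qed
  from annulus_coeff_bound[OF this, of 0 r 0]
  have "norm (f c) * (pi * r\<^sup>2) \<le> (LINT w:{w. norm w < r}|lborel. norm (f (c + w)))"
    using r by simp
  also have "\<dots> = (LINT w|distr lborel borel (\<lambda>w. c + w). indicator (ball c r) w *\<^sub>R norm (f w))"
  proof -
    have "continuous_on (ball c r) f"
      using holf r by (intro holomorphic_on_imp_continuous_on) (auto elim: holomorphic_on_subset)
    then have "(\<lambda>w. indicator (ball c r) w *\<^sub>R norm (f w)) \<in> borel_measurable borel"
      by (intro borel_measurable_continuous_on_indicator continuous_intros) auto
    then show ?thesis
      unfolding set_lebesgue_integral_def
      by (subst integral_distr) (auto simp: indicator_def dist_norm intro!: Bochner_Integration.integral_cong)
  qed
  also have "\<dots> = (LINT w:ball c r|lborel. norm (f w))"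
    by (simp add: lborel_distr_plus set_lebesgue_integral_def)
  finally show ?thesis .
qed

section \<open>Growth of Bergman functions\<close>

lemma disk_area_eq_density:
  "disk_area = density (restrict_space lborel (ball 0 1)) (\<lambda>_. ennreal (1 / pi))"
  unfolding disk_area_def
  by (rule measure_eqI) (auto simp: emeasure_density_const)

lemma space_disk_area [simp]: "space disk_area = ball 0 1"
  by (simp add: disk_area_def space_scale_measure space_restrict_space)

lemma sets_disk_area: "sets disk_area = sets (restrict_space borel (ball 0 1))"
  by (simp add: disk_area_def sets_restrict_space)

lemma id_measurable_disk_area [measurable]: "(\<lambda>z. z) \<in> borel_measurable disk_area"
  by (subst measurable_cong_sets[OF sets_disk_area refl]) (intro measurable_restrict_space1 measurable_ident_sets refl)

lemma borel_measurable_disk_area_iff: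
  "g \<in> borel_measurable disk_area \<longleftrightarrow> g \<in> borel_measurable (restrict_space lborel (ball 0 1))"
  by (intro arg_cong2[of _ _ _ _ "(\<in>)"] measurable_cong_sets)
     (simp_all add: sets_disk_area sets_restrict_space)

lemma continuous_on_imp_measurable_disk_area:
  fixes g :: "complex \<Rightarrow> 'b::topological_space"
  assumes "continuous_on (ball 0 1) g"
  shows "g \<in> borel_measurable disk_area"
  using borel_measurable_continuous_on_restrict[OF assms]
  by (subst measurable_cong_sets[OF sets_disk_area refl])

lemma disk_area_integrable_iff:
  fixes g :: "complex \<Rightarrow> real"
  shows "integrable disk_area g \<longleftrightarrow> set_integrable lborel (ball 0 1) g"
proof (cases "g \<in> borel_measurable (restrict_space lborel (ball 0 1))")
  case True
  then have "integrable disk_area g \<longleftrightarrow>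
      integrable (restrict_space lborel (ball 0 1)) (\<lambda>x. (1 / pi) *\<^sub>R g x)"
    unfolding disk_area_eq_density by (intro integrable_density) auto
  also have "\<dots> \<longleftrightarrow> integrable (restrict_space lborel (ball 0 1)) g"
    by (simp only: real_scaleR_def integrable_mult_left_iff) simp
  also have "\<dots> \<longleftrightarrow> set_integrable lborel (ball 0 1) g"
    unfolding set_integrable_def by (subst integrable_restrict_space) auto
  finally show ?thesis .
next
  case False
  then have "\<not> integrable disk_area g"
    using borel_measurable_integrable[of disk_area g] borel_measurable_disk_area_iff by blast
  moreover have "\<not> set_integrable lborel (ball 0 1) g"
    using False borel_measurable_integrable[of "restrict_space lborel (ball 0 1)" g]
    unfolding set_integrable_def
    by (subst integrable_restrict_space[symmetric]) auto
  ultimately show ?thesis by simp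
qed

lemma disk_area_integral:
  fixes g :: "complex \<Rightarrow> real"
  assumes "g \<in> borel_measurable disk_area"
  shows "(LINT z|disk_area. g z) = (1 / pi) * (LINT z:ball 0 1|lborel. g z)"
proof -
  have "(LINT z|disk_area. g z) = (LINT z|restrict_space lborel (ball 0 1). (1 / pi) *\<^sub>R g z)"
    unfolding disk_area_eq_density
    using assms by (intro integral_density) (auto simp: borel_measurable_disk_area_iff)
  also have "\<dots> = (1 / pi) * (LINT z:ball 0 1|lborel. g z)"
    unfolding set_lebesgue_integral_def by (subst integral_restrict_space) auto
  finally show ?thesis .
qed

lemma bergman_continuous: "f \<in> bergman p \<Longrightarrow> continuous_on (ball 0 1) f"
  by (auto simp: bergman_def intro: holomorphic_on_imp_continuous_on)

lemma bergman_set_integrable: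
  "f \<in> bergman p \<Longrightarrow> set_integrable lborel (ball 0 1) (\<lambda>z. cmod (f z) powr p)"
  by (simp add: bergman_def disk_area_integrable_iff)

lemma bergman_LINT:
  "f \<in> bergman p \<Longrightarrow>
    (LINT z:ball 0 1|lborel. cmod (f z) powr p) = pi * (LINT z|disk_area. cmod (f z) powr p)"
  by (subst disk_area_integral) (auto simp: bergman_def)

lemma bergman_subset_integral_le:
  assumes f: "f \<in> bergman p" and B: "B \<subseteq> ball 0 1" "B \<in> sets borel"
  shows "(LINT z:B|lborel. cmod (f z) powr p) \<le> pi * (LINT z|disk_area. cmod (f z) powr p)"
proof -
  have "set_integrable lborel B (\<lambda>z. cmod (f z) powr p)"
    using bergman_set_integrable[OF f] B by - (rule set_integrable_subset, auto)
  then have "(LINT z:B|lborel. cmod (f z) powr p) \<le> (LINT z:ball 0 1|lborel. cmod (f z) powr p)"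
    using bergman_set_integrable[OF f] B
    unfolding set_lebesgue_integral_def set_integrable_def
    by (intro integral_mono) (auto simp: indicator_def)
  then show ?thesis by (simp add: bergman_LINT[OF f])
qed

text \<open>
  Trades the first power of \<open>x\<close> for the power \<open>p\<close> when an upper bound
  on \<open>x\<close> is known.
\<close>

lemma le_powr_interpolate:
  fixes x B p :: real
  assumes "0 \<le> x" "x \<le> B" "p \<le> 1"
  shows "x \<le> x powr p * B powr (1 - p)"
proof (cases "x = 0")
  case False
  then have "x = x powr p * x powr (1 - p)"
    using assms by (simp flip: powr_add)
  also have "\<dots> \<le> x powr p * B powr (1 - p)"
    using assms False by (intro mult_left_mono powr_mono2) auto
  finally show ?thesis .
qed auto

text \<open>
  Let \<open>w0\<close> maximize \<open>h w = |f w| (R - |w|) powr (2 / p)\<close> on the disk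
  of radius \<open>R < 1\<close>, with maximum \<open>M\<close>, and put \<open>r = (R - |w0|) /
  2\<close>. On the ball of radius \<open>r\<close> about \<open>w0\<close>, \<open>|f|\<close>
  is at most \<open>M r powr (- 2 / p)\<close>, so the mean value inequality and \<open>|f| =
  |f| powr p * |f| powr (1 - p)\<close> give \<open>M \<le> C M powr (1 - p) \<integral> |f|
  powr p\<close>. Unless \<open>M = 0\<close>, one may cancel \<open>M powr (1 - p)\<close>, and
  then let \<open>R\<close> tend to \<open>1\<close>.
\<close>

lemma bergman_growth:
  assumes p: "0 < p" "p \<le> 1" and f: "f \<in> bergman p" and z: "norm z < 1"
  shows "norm (f z) * (1 - norm z) powr (2 / p) \<le> 2 powr (2 / p\<^sup>2) * bergman_norm p f"
proof -
  define I where "I = (LINT z|disk_area. cmod (f z) powr p)"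
  have I0: "0 \<le> I" unfolding I_def by (intro integral_nonneg_AE) auto
  have holf: "f holomorphic_on ball 0 1" using f by (simp add: bergman_def)
  have key: "norm (f z) * (R - norm z) powr (2 / p) \<le> 2 powr (2 / p\<^sup>2) * I powr (1 / p)"
    if R: "norm z < R" "R < 1" for R
  proof -
    define h where "h = (\<lambda>w. norm (f w) * (R - norm w) powr (2 / p))"
    have "0 < R" using R norm_ge_zero[of z] by linarith
    have "continuous_on (cball 0 R) h"
    proof -
      have "continuous_on (cball 0 R) f"
        using R by (intro continuous_on_subset[OF bergman_continuous[OF f]]) auto
      then show ?thesis unfolding h_def using p
        by (intro continuous_intros continuous_on_powr') auto
    qed
    then obtain w0 where w0: "w0 \<in> cball 0 R" and max: "\<And>w. w \<in> cball 0 R \<Longrightarrow> h w \<le> h w0"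
      using continuous_attains_sup[of "cball 0 R" h] \<open>0 < R\<close> by auto
    define M where "M = h w0"
    have "h z \<le> M" using max[of z] R by (simp add: M_def)
    have "M \<le> 2 powr (2 / p\<^sup>2) * I powr (1 / p)"
    proof (cases "M \<le> 0")
      case True
      then show ?thesis by (rule order_trans) simp
    next
      case False
      then have M: "0 < M" by simp
      \<comment> \<open>the maximum is positive, while \<open>h\<close> vanishes on the boundary circle\<close>
      then have w0R: "norm w0 < R"
        using w0 p by (cases "norm w0 = R") (auto simp: M_def h_def)
      define r where "r = (R - norm w0) / 2"
      have "R - norm w0 < 2" using R(2) norm_ge_zero[of w0] by linarith
      then have "r < 1" by (simp add: r_def)
      with w0R have r: "0 < r" "r < 1" by (simp_all add: r_def)
      have sub: "ball w0 (2 * r) \<subseteq> ball 0 R"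
      proof
        fix w assume "w \<in> ball w0 (2 * r)"
        then have "norm (w - w0) < 2 * r" by (simp add: dist_norm norm_minus_commute)
        then have "norm w < 2 * r + norm w0"
          using norm_triangle_ineq[of "w - w0" w0] by simp
        moreover have "2 * r + norm w0 = R" by (simp add: r_def field_simps)
        ultimately show "w \<in> ball 0 R" by simp
      qed
      have subr: "ball w0 r \<subseteq> ball 0 R"
        using subset_ball[of r "2 * r" w0] sub r by (simp add: subset_iff)
      also have "\<dots> \<subseteq> ball 0 1" using R by (intro subset_ball) simp
      finally have sub1: "ball w0 r \<subseteq> ball 0 1" .
      have bd: "norm (f w) \<le> M * r powr (- (2 / p))" if "w \<in> ball w0 r" for w
      proof -
        have "w \<in> cball 0 R" using subr that by (auto simp: subset_iff)
        have "norm (w - w0) < r" using that by (simp add: dist_norm norm_minus_commute)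
        then have "r \<le> R - norm w"
          using norm_triangle_ineq[of "w - w0" w0] by (simp add: r_def)
        then have "norm (f w) * r powr (2 / p) \<le> h w"
          unfolding h_def using r p by (intro mult_left_mono powr_mono2) auto
        also have "\<dots> \<le> M" using max[OF \<open>w \<in> cball 0 R\<close>] by (simp add: M_def)
        finally show ?thesis using r by (simp add: powr_minus field_simps)
      qed
      have intp: "set_integrable lborel (ball w0 r) (\<lambda>z. cmod (f z) powr p)"
        using bergman_set_integrable[OF f] sub1 by - (rule set_integrable_subset, auto)
      define K where "K = (M * r powr (- (2 / p))) powr (1 - p)"
      have "norm (f w0) * (pi * r\<^sup>2) \<le> (LINT w:ball w0 r|lborel. norm (f w))"
        using holf r sub R
        by (intro mean_value_ball[of _ _ "2 * r"]) (auto elim!: holomorphic_on_subset)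
      also have "\<dots> \<le> (LINT w:ball w0 r|lborel. norm (f w) powr p * K)"
      proof (rule set_integral_mono)
        have "set_integrable lborel (cball w0 r) f"
          unfolding set_integrable_def
        proof (rule borel_integrable_compact)
          have "cball w0 r \<subseteq> ball w0 (2 * r)" using r by auto
          then show "continuous_on (cball w0 r) f"
            using sub subset_ball[of R 1 "0::complex"] R
            by (intro continuous_on_subset[OF bergman_continuous[OF f]]) simp
        qed auto
        then show "set_integrable lborel (ball w0 r) (\<lambda>w. norm (f w))"
          by (intro set_integrable_norm) (auto elim: set_integrable_subset)
        show "set_integrable lborel (ball w0 r) (\<lambda>w. norm (f w) powr p * K)"
          using set_integrable_mult_left[of K, OF intp] by simp
        show "norm (f w) \<le> norm (f w) powr p * K" if "w \<in> ball w0 r" for w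
          unfolding K_def using bd[OF that] p by (intro le_powr_interpolate) auto
      qed
      also have "\<dots> = (LINT w:ball w0 r|lborel. norm (f w) powr p) * K" by simp
      also have "\<dots> \<le> pi * I * K"
        unfolding I_def
        by (intro mult_right_mono bergman_subset_integral_le f sub1) (auto simp: K_def)
      finally have "norm (f w0) * r\<^sup>2 \<le> I * K" by (simp add: algebra_simps)
      moreover have "K = M powr (1 - p) * r powr (2 - 2 / p)"
      proof -
        have "- (2 / p) * (1 - p) = 2 - 2 / p" using p by (simp add: field_simps)
        then show ?thesis
          using M r by (simp only: K_def powr_mult powr_powr less_imp_le powr_ge_zero)
      qed
      moreover have "r powr (2 - 2 / p) = r\<^sup>2 * r powr (- (2 / p))"
        using r by (simp add: powr_diff powr_minus field_simps)
      ultimately have "norm (f w0) * r\<^sup>2 \<le> (I * M powr (1 - p) * r powr (- (2 / p))) * r\<^sup>2"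
        by (simp add: algebra_simps)
      then have fw0: "norm (f w0) \<le> I * M powr (1 - p) * r powr (- (2 / p))"
        by (rule mult_right_le_imp_le) (use r in simp)
      have "M = norm (f w0) * (2 * r) powr (2 / p)"
      proof -
        have "2 * r = R - norm w0" by (simp add: r_def field_simps)
        then show ?thesis by (simp add: M_def h_def)
      qed
      also have "\<dots> \<le> I * M powr (1 - p) * r powr (- (2 / p)) * (2 * r) powr (2 / p)"
        by (intro mult_right_mono fw0) auto
      also have "\<dots> = 2 powr (2 / p) * I * M powr (1 - p)"
        using r by (simp add: powr_mult powr_minus field_simps)
      finally have "M powr p * M powr (1 - p) \<le> 2 powr (2 / p) * I * M powr (1 - p)"
        using M by (simp flip: powr_add)
      then have "M powr p \<le> 2 powr (2 / p) * I"
        using M by (simp add: mult_le_cancel_right)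
      then have "(M powr p) powr (1 / p) \<le> (2 powr (2 / p) * I) powr (1 / p)"
        using p by (intro powr_mono2) auto
      then show ?thesis
        using M p I0 by (simp add: powr_powr powr_mult power2_eq_square)
    qed
    with \<open>h z \<le> M\<close> show ?thesis by (simp add: h_def)
  qed
  have "((\<lambda>R. norm (f z) * (R - norm z) powr (2 / p)) \<longlongrightarrow>
      norm (f z) * (1 - norm z) powr (2 / p)) (at_left 1)"
    using z by (intro tendsto_intros) auto
  moreover have "eventually (\<lambda>R. norm (f z) * (R - norm z) powr (2 / p)
      \<le> 2 powr (2 / p\<^sup>2) * I powr (1 / p)) (at_left (1::real))"
    using eventually_at_left_real[OF z] by eventually_elim (auto intro!: key)
  ultimately have "norm (f z) * (1 - norm z) powr (2 / p) \<le> 2 powr (2 / p\<^sup>2) * I powr (1 / p)"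
    by (rule tendsto_upperbound) auto
  then show ?thesis by (simp add: I_def bergman_norm_def)
qed

section \<open>Taylor coefficients of Bergman functions\<close>

lemma taylor_coeff_altdef: "taylor_coeff f k = (deriv ^^ k) f 0 / fact k"
  by (simp add: taylor_coeff_def fps_expansion_def)

lemma taylor_sums:
  assumes "f holomorphic_on ball 0 1" "norm z < 1"
  shows "(\<lambda>k. taylor_coeff f k * z ^ k) sums f z"
  using holomorphic_power_series[OF assms(1), of z] assms(2) by (simp add: taylor_coeff_altdef)

text \<open>
  The inner radius \<open>k / (k + 1)\<close> is close enough to \<open>1\<close> for its power
  \<open>2 * k\<close> to stay away from \<open>0\<close>; for \<open>k = 0\<close> this power
  is \<open>0 ^ 0 = 1\<close>.
\<close>

lemma radius_power_lower_bound: "exp (-2) \<le> (real k / (real k + 1)) ^ (2 * k)"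
proof (cases "k = 0")
  case False
  have "(1 + 1 / real k) ^ (2 * k) \<le> exp (1 / real k) ^ (2 * k)"
    by (intro power_mono exp_ge_add_one_self) auto
  also have "\<dots> = exp 2"
    using False by (simp flip: exp_of_nat_mult)
  finally have "exp (-2) \<le> 1 / (1 + 1 / real k) ^ (2 * k)"
    using False by (simp add: exp_minus field_simps add_pos_pos)
  also have "\<dots> = (real k / (real k + 1)) ^ (2 * k)"
    using False by (simp add: field_simps power_divide)
  finally show ?thesis .
qed auto

text \<open>
  The annuli adapted to the coefficients: the \<open>k\<close>-th one is at distance about
  \<open>1 / k\<close> from the unit circle, where \<open>|w| ^ k\<close> is of order
  \<open>1\<close>, has area about \<open>1 / k\<^sup>2\<close>, and is disjoint from the
  others.
\<close>

definition coeff_annulus :: "nat \<Rightarrow> complex set" where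
  "coeff_annulus k = {w. real k / (real k + 1) \<le> norm w \<and> norm w < (real k + 1) / (real k + 2)}"

lemma coeff_annulus_borel [measurable]: "coeff_annulus k \<in> sets borel"
  unfolding coeff_annulus_def by (rule borel_annulus)

lemma disjoint_coeff_annulus: "disjoint_family coeff_annulus"
proof -
  have *: "coeff_annulus j \<inter> coeff_annulus k = {}" if "j < k" for j k
  proof -
    have "(real j + 1) / (real j + 2) \<le> real k / (real k + 1)"
      using that by (simp add: field_simps)
    then show ?thesis by (auto simp: coeff_annulus_def)
  qed
  show ?thesis unfolding disjoint_family_on_def
    using * by (metis Int_commute linorder_neqE_nat)
qed

text \<open>
  The area of the annulus costs a factor \<open>(k + 2)\<^sup>2\<close>. Replacing
  \<open>|f|\<close> by \<open>|f| powr p\<close> through the growth bound costs \<open>(k + 2)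
  powr (2 / p * (1 - p)) = (k + 2) powr (2 / p - 2)\<close>. Together they give exactly
  \<open>(k + 2) powr (2 / p)\<close>.
\<close>

lemma coeff_annulus_bound:
  assumes p: "0 < p" "p \<le> 1" and f: "f \<in> bergman p"
  shows "norm (taylor_coeff f k) * (real k + 2) powr (- (2 / p))
    \<le> 4 * exp 2 / pi * (2 powr (2 / p\<^sup>2) * bergman_norm p f) powr (1 - p)
       * (LINT w:coeff_annulus k|lborel. norm (f w) powr p)"
proof -
  define G where "G = 2 powr (2 / p\<^sup>2) * bergman_norm p f"
  define m where "m = real k + 2"
  define r R where "r = real k / (real k + 1)" and "R = (real k + 1) / (real k + 2)"
  have m: "2 \<le> m" by (simp add: m_def)
  have rR: "0 \<le> r" "r \<le> R" "R < 1" "1 - R = 1 / m"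
    by (simp_all add: r_def R_def m_def field_simps)
  have A: "coeff_annulus k = {w. r \<le> norm w \<and> norm w < R}"
    by (simp add: coeff_annulus_def r_def R_def)
  have sub: "coeff_annulus k \<subseteq> ball 0 1" using rR by (auto simp: A)
  have intp: "set_integrable lborel (coeff_annulus k) (\<lambda>z. cmod (f z) powr p)"
    using bergman_set_integrable[OF f] sub by - (rule set_integrable_subset, auto)
  have holf: "f holomorphic_on ball 0 1" using f by (simp add: bergman_def)
  define J where "J = (LINT w:coeff_annulus k|lborel. norm (f w) powr p)"
  have area: "1 / (4 * m\<^sup>2) \<le> R\<^sup>2 - r\<^sup>2"
  proof -
    have "R\<^sup>2 - r\<^sup>2 = (R - r) * (R + r)" by (simp add: power2_eq_square algebra_simps)
    moreover have "1 / m\<^sup>2 \<le> R - r"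
    proof -
      have "R - r = 1 / ((real k + 1) * m)" by (simp add: r_def R_def m_def field_simps)
      moreover have "(real k + 1) * m \<le> m\<^sup>2"
        unfolding power2_eq_square using m by (intro mult_right_mono) (auto simp: m_def)
      ultimately show ?thesis using m by (simp add: frac_le m_def)
    qed
    moreover have "1 / 4 \<le> R + r"
    proof -
      have "1 / 4 \<le> R" by (simp add: R_def field_simps)
      then show ?thesis using rR by simp
    qed
    ultimately have "1 / m\<^sup>2 * (1 / 4) \<le> R\<^sup>2 - r\<^sup>2"
      using rR by (simp only:) (intro mult_mono, auto)
    then show ?thesis by simp
  qed
  have "norm (taylor_coeff f k) * (exp (-2) * (pi * (1 / (4 * m\<^sup>2))))
      \<le> norm (taylor_coeff f k) * (r ^ (2 * k) * (pi * (R\<^sup>2 - r\<^sup>2)))"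
    using radius_power_lower_bound[of k] area rR
    by (intro mult_left_mono mult_mono) (auto simp: r_def)
  also have "\<dots> \<le> (LINT w:coeff_annulus k|lborel. norm (f w))"
    unfolding A taylor_coeff_altdef using rR
    by (intro annulus_coeff_bound[OF holf]) auto
  also have "\<dots> \<le> (LINT w:coeff_annulus k|lborel. norm (f w) powr p * (G powr (1 - p) * m powr (2 / p - 2)))"
  proof (rule set_integral_mono)
    have "cball 0 R \<subseteq> ball (0::complex) 1" using rR by auto
    then show "set_integrable lborel (coeff_annulus k) (\<lambda>w. norm (f w))"
      unfolding A
      by (intro set_integrable_annulus continuous_intros continuous_on_subset[OF bergman_continuous[OF f]])
    show "set_integrable lborel (coeff_annulus k)
        (\<lambda>w. norm (f w) powr p * (G powr (1 - p) * m powr (2 / p - 2)))"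
      by (intro set_integrable_mult_left intp)
    fix w assume w: "w \<in> coeff_annulus k"
    have "norm w < 1" using sub w by auto
    have "1 / m \<le> 1 - norm w" using w rR by (simp add: A)
    have "norm (f w) * (1 / m) powr (2 / p) \<le> norm (f w) * (1 - norm w) powr (2 / p)"
      using \<open>1 / m \<le> 1 - norm w\<close> m p by (intro mult_left_mono powr_mono2) auto
    also have "\<dots> \<le> G"
      unfolding G_def by (rule bergman_growth[OF p f \<open>norm w < 1\<close>])
    finally have le: "norm (f w) \<le> G * m powr (2 / p)"
      using m by (simp add: powr_divide field_simps)
    have "G \<ge> 0" by (simp add: G_def bergman_norm_def)
    have "2 / p * (1 - p) = 2 / p - 2" using p by (simp add: field_simps)
    then have "(G * m powr (2 / p)) powr (1 - p) = G powr (1 - p) * m powr (2 / p - 2)"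
      using m \<open>G \<ge> 0\<close> by (simp only: powr_mult powr_powr powr_ge_zero)
    with le_powr_interpolate[OF norm_ge_zero le p(2)]
    show "norm (f w) \<le> norm (f w) powr p * (G powr (1 - p) * m powr (2 / p - 2))" by simp
  qed
  also have "\<dots> = J * G powr (1 - p) * m powr (2 / p - 2)" by (simp add: J_def)
  also have "\<dots> = J * G powr (1 - p) * m powr (2 / p) / m\<^sup>2"
    using m by (simp add: powr_diff)
  finally have "norm (taylor_coeff f k) \<le> 4 * exp 2 / pi * G powr (1 - p) * J * m powr (2 / p)"
    using m by (simp add: exp_minus field_simps)
  then show ?thesis
    using m by (simp add: powr_minus G_def m_def J_def field_simps)
qed

lemma bergman_norm_powr: "p \<noteq> 0 \<Longrightarrow> bergman_norm p f powr p = (LINT z|disk_area. cmod (f z) powr p)"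
  by (simp add: bergman_norm_def powr_powr integral_nonneg_AE)

text \<open>
  A substitute for the Hardy-Littlewood inequality on the coefficients of Bergman functions.
  Summing the bounds for single coefficients is lossless because the annuli are disjoint.
\<close>

lemma bergman_coeff_sum:
  assumes p: "0 < p" "p \<le> 1" and f: "f \<in> bergman p"
  shows "summable (\<lambda>k. norm (taylor_coeff f k) * (real k + 2) powr (- (2 / p)))"
    and "(\<Sum>k. norm (taylor_coeff f k) * (real k + 2) powr (- (2 / p)))
       \<le> 4 * exp 2 * (2 powr (2 / p\<^sup>2)) powr (1 - p) * bergman_norm p f"
proof -
  let ?a = "\<lambda>k. norm (taylor_coeff f k) * (real k + 2) powr (- (2 / p))"
  define G where "G = 2 powr (2 / p\<^sup>2) * bergman_norm p f"
  define I where "I = (LINT z|disk_area. cmod (f z) powr p)"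
  have I: "I = bergman_norm p f powr p" using p by (simp add: I_def bergman_norm_powr)
  define c where "c = 4 * exp 2 / pi * G powr (1 - p)"
  have "0 \<le> c" by (simp add: c_def)
  have sub: "coeff_annulus k \<subseteq> ball 0 1" for k
  proof -
    have "(real k + 1) / (real k + 2) \<le> 1" by simp
    then show ?thesis
      unfolding coeff_annulus_def by (force intro: less_le_trans)
  qed
  have intp: "set_integrable lborel (coeff_annulus k) (\<lambda>z. cmod (f z) powr p)" for k
    using bergman_set_integrable[OF f] sub[of k] by - (rule set_integrable_subset, auto)
  have "(\<Sum>k<n. ?a k) \<le> 4 * exp 2 * (2 powr (2 / p\<^sup>2)) powr (1 - p) * bergman_norm p f" for n
  proof -
    have "(\<Sum>k<n. ?a k) \<le> (\<Sum>k<n. c * (LINT w:coeff_annulus k|lborel. norm (f w) powr p))"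
      unfolding c_def G_def by (intro sum_mono coeff_annulus_bound p f)
    also have "\<dots> = c * (LINT w:(\<Union>k\<in>{..<n}. coeff_annulus k)|lborel. norm (f w) powr p)"
      unfolding sum_distrib_left[symmetric]
      by (subst set_integral_finite_Union)
         (use disjoint_coeff_annulus in \<open>auto intro: intp elim: disjoint_family_on_mono[rotated]\<close>)
    also have "\<dots> \<le> c * (pi * I)"
      unfolding I_def
      using sub by (intro mult_left_mono bergman_subset_integral_le f \<open>0 \<le> c\<close>) auto
    also have "\<dots> = 4 * exp 2 * (2 powr (2 / p\<^sup>2)) powr (1 - p) *
        (bergman_norm p f powr (1 - p) * bergman_norm p f powr p)"
      by (simp add: c_def G_def I powr_mult bergman_norm_def)
    also have "bergman_norm p f powr (1 - p) * bergman_norm p f powr p = bergman_norm p f"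
      by (simp add: bergman_norm_def flip: powr_add)
    finally show ?thesis .
  qed
  note bd = this
  show "summable ?a"
    by (rule bounded_imp_summable[of _ "4 * exp 2 * (2 powr (2 / p\<^sup>2)) powr (1 - p) * bergman_norm p f"])
       (use bd[of "Suc _"] in \<open>auto simp: lessThan_Suc_atMost\<close>)
  then show "(\<Sum>k. ?a k) \<le> 4 * exp 2 * (2 powr (2 / p\<^sup>2)) powr (1 - p) * bergman_norm p f"
    by (rule suminf_le_const) (rule bd)
qed

section \<open>Dyadic estimates of power integrals\<close>

lemma dyadic_bracket:
  fixes y :: real
  assumes "1 \<le> y"
  shows "\<exists>j. 2 ^ j \<le> y \<and> y < 2 ^ Suc j"
proof -
  have "y < 2 ^ n \<Longrightarrow> \<exists>j. 2 ^ j \<le> y \<and> y < 2 ^ Suc j" for n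
  proof (induction n)
    case (Suc n)
    then show ?case by (cases "y < 2 ^ n") (auto intro: exI[of _ n])
  qed (use assms in simp)
  moreover obtain n where "y < 2 ^ n" using real_arch_pow[of 2 y] by auto
  ultimately show ?thesis by blast
qed

lemma dyadic_powr_bound:
  fixes y b :: real
  assumes "2 ^ j \<le> y" "y < 2 ^ Suc j"
  shows "y powr b \<le> 2 powr \<bar>b\<bar> * (2 powr b) ^ j"
proof -
  have pj: "(2 powr b) ^ j = (2 ^ j) powr b"
    by (simp add: powr_powr powr_realpow[symmetric] mult.commute)
  have "0 < y" using assms(1) by (rule less_le_trans[rotated]) simp
  show ?thesis
  proof (cases "b \<ge> 0")
    case True
    then have "y powr b \<le> (2 * 2 ^ j) powr b"
      using assms \<open>0 < y\<close> by (intro powr_mono2) auto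
    then show ?thesis using True by (simp add: pj powr_mult)
  next
    case False
    then have "y powr b \<le> (2 ^ j) powr b"
      using assms \<open>0 < y\<close> by (intro powr_mono2') auto
    also have "\<dots> \<le> 2 powr \<bar>b\<bar> * (2 ^ j) powr b"
      using ge_one_powr_ge_zero[of 2 "\<bar>b\<bar>"] mult_right_mono[of 1 "2 powr \<bar>b\<bar>" "(2 ^ j) powr b"] by simp
    finally show ?thesis by (simp add: pj)
  qed
qed

text \<open>
  Decompose the space into the shells on which \<open>y\<close> lies between consecutive powers
  of two and sum a geometric series. The exponent \<open>b\<close> may have either sign; the
  three applications are the two ranges of the kernel on the disk and the weighted Carleson
  measure.
\<close>

lemma nn_integral_dyadic_bound:
  fixes y :: "'a \<Rightarrow> real"
  assumes [measurable]: "y \<in> borel_measurable M"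
    and y1: "\<And>x. x \<in> space M \<Longrightarrow> 1 \<le> y x"
    and shell: "\<And>j. emeasure M {x \<in> space M. 2 ^ j \<le> y x \<and> y x < 2 ^ Suc j} \<le> ennreal (B * q ^ j)"
    and B: "0 \<le> B" and q: "0 \<le> q" "2 powr b * q < 1"
  shows "(\<integral>\<^sup>+x. ennreal (y x powr b) \<partial>M) \<le> ennreal (2 powr \<bar>b\<bar> * B / (1 - 2 powr b * q))"
proof -
  define E where "E = (\<lambda>j. {x \<in> space M. 2 ^ j \<le> y x \<and> y x < 2 ^ Suc j})"
  have [measurable]: "E j \<in> sets M" for j unfolding E_def by measurable
  have "(\<integral>\<^sup>+x. ennreal (y x powr b) \<partial>M)
      \<le> (\<integral>\<^sup>+x. (\<Sum>j. ennreal (2 powr \<bar>b\<bar> * (2 powr b) ^ j) * indicator (E j) x) \<partial>M)"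
  proof (rule nn_integral_mono)
    fix x assume x: "x \<in> space M"
    then obtain j where j: "2 ^ j \<le> y x" "y x < 2 ^ Suc j" using dyadic_bracket[OF y1] by blast
    have "ennreal (y x powr b) \<le> ennreal (2 powr \<bar>b\<bar> * (2 powr b) ^ j) * indicator (E j) x"
      using dyadic_powr_bound[OF j] j x by (simp add: E_def ennreal_leI)
    also have "\<dots> \<le> (\<Sum>j. ennreal (2 powr \<bar>b\<bar> * (2 powr b) ^ j) * indicator (E j) x)"
    proof -
      have "h j \<le> (\<Sum>j. h j)" for h :: "nat \<Rightarrow> ennreal"
        using sum_le_suminf[of h "{j}"] by simp
      then show ?thesis .
    qed
    finally show "ennreal (y x powr b) \<le> \<dots>" .
  qed
  also have "\<dots> = (\<Sum>j. ennreal (2 powr \<bar>b\<bar> * (2 powr b) ^ j) * emeasure M (E j))"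
    by (subst nn_integral_suminf) (auto simp: nn_integral_cmult)
  also have "\<dots> \<le> (\<Sum>j. ennreal (2 powr \<bar>b\<bar> * B * (2 powr b * q) ^ j))"
  proof (rule suminf_le)
    fix j
    have "ennreal (2 powr \<bar>b\<bar> * (2 powr b) ^ j) * emeasure M (E j)
        \<le> ennreal (2 powr \<bar>b\<bar> * (2 powr b) ^ j) * ennreal (B * q ^ j)"
      unfolding E_def by (intro mult_left_mono shell) auto
    also have "\<dots> = ennreal (2 powr \<bar>b\<bar> * B * (2 powr b * q) ^ j)"
      by (subst ennreal_mult[symmetric]) (use B q in \<open>auto simp: power_mult_distrib algebra_simps\<close>)
    finally show "ennreal (2 powr \<bar>b\<bar> * (2 powr b) ^ j) * emeasure M (E j) \<le> \<dots>" .
  qed auto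
  also have "\<dots> = ennreal (\<Sum>j. 2 powr \<bar>b\<bar> * B * (2 powr b * q) ^ j)"
    using B q by (intro suminf_ennreal2 summable_mult summable_geometric) auto
  also have "(\<Sum>j. 2 powr \<bar>b\<bar> * B * (2 powr b * q) ^ j) = 2 powr \<bar>b\<bar> * B / (1 - 2 powr b * q)"
    using q by (subst suminf_mult) (auto simp: suminf_geometric)
  finally show ?thesis .
qed

section \<open>The kernel \<open>|1 - t z| powr (- c)\<close> on the disk\<close>

lemma emeasure_disk_area:
  assumes "A \<subseteq> ball 0 1" "A \<in> sets borel"
  shows "emeasure disk_area A = ennreal (1 / pi) * emeasure lborel A"
  using assms by (simp add: disk_area_def emeasure_restrict_space)

text \<open>
  The condition \<open>|1 - t z| \<le> y\<close> describes the disk of radius \<open>y /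
  t\<close> about \<open>1 / t\<close>. This is of radius at most \<open>2 * y\<close> for
  \<open>t \<ge> 1 / 2\<close>; for smaller \<open>t\<close> the kernel exceeds \<open>1 /
  2\<close> on the whole disk, whose normalized area \<open>1\<close> is at most \<open>4 *
  y\<^sup>2\<close> when \<open>y \<ge> 1 / 2\<close>.
\<close>

lemma emeasure_disk_area_kernel_sublevel:
  assumes t: "0 \<le> t" "t < 1" and y: "0 < y"
  shows "emeasure disk_area {z \<in> ball (0::complex) 1. norm (1 - of_real t * z) \<le> y} \<le> ennreal (4 * y\<^sup>2)"
proof -
  have [measurable]: "{z \<in> ball (0::complex) 1. norm (1 - of_real t * z) \<le> y} \<in> sets borel" by measurable
  have eq: "emeasure disk_area {z \<in> ball (0::complex) 1. norm (1 - of_real t * z) \<le> y}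
      = ennreal (1 / pi) * emeasure lborel {z \<in> ball (0::complex) 1. norm (1 - of_real t * z) \<le> y}"
    by (rule emeasure_disk_area) auto
  have disc: "emeasure lborel (cball c r) = ennreal (pi * r\<^sup>2)" if "0 \<le> r" for c :: complex and r
    using that by (simp add: emeasure_cball unit_ball_vol_2)
  show ?thesis
  proof (cases "y < 1 / 2 \<and> t < 1 / 2")
    case True
    have "{z \<in> ball (0::complex) 1. norm (1 - of_real t * z) \<le> y} = {}"
    proof -
      have "1 / 2 < norm (1 - of_real t * z)" if "norm z < 1" for z :: complex
      proof -
        have "norm (of_real t * z) \<le> t * 1"
          using that t by (simp add: norm_mult mult_left_le)
        then show ?thesis
          using norm_triangle_ineq2[of 1 "of_real t * z"] True by simp
      qed
      then show ?thesis using True by force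
    qed
    then show ?thesis by (simp only: emeasure_empty zero_le)
  next
    case False
    have "emeasure lborel {z \<in> ball (0::complex) 1. norm (1 - of_real t * z) \<le> y} \<le> ennreal (pi * (2 * y)\<^sup>2)"
    proof (cases "t < 1 / 2")
      case True
      have "emeasure lborel {z \<in> ball (0::complex) 1. norm (1 - of_real t * z) \<le> y}
          \<le> emeasure lborel (cball 0 1 :: complex set)"
        by (intro emeasure_mono) auto
      also have "\<dots> \<le> ennreal (pi * (2 * y)\<^sup>2)"
      proof -
        have "1 \<le> (2 * y)\<^sup>2" using False True by (intro one_le_power) auto
        then have "pi * 1\<^sup>2 \<le> pi * (2 * y)\<^sup>2" by (intro mult_left_mono) auto
        then show ?thesis by (simp only: disc zero_le_one ennreal_leI)
      qed
      finally show ?thesis .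
    next
      case False
      have "{z \<in> ball (0::complex) 1. norm (1 - of_real t * z) \<le> y} \<subseteq> cball (of_real (1 / t)) (2 * y)"
      proof
        fix z :: complex assume "z \<in> {z \<in> ball (0::complex) 1. norm (1 - of_real t * z) \<le> y}"
        then have z: "norm (1 - of_real t * z) \<le> y" by simp
        have "of_real (1 / t) - z = (1 - of_real t * z) / of_real t"
          using False by (simp add: field_simps)
        then have "norm (of_real (1 / t) - z) = norm (1 - of_real t * z) / t"
          using t by (simp add: norm_divide)
        also have "\<dots> \<le> 2 * y"
        proof -
          have "norm (1 - of_real t * z) \<le> 1 * y" using z by simp
          also have "\<dots> \<le> (2 * t) * y" using False y by (intro mult_right_mono) auto
          finally show ?thesis using False by (simp add: field_simps)
        qed
        finally show "z \<in> cball (of_real (1 / t)) (2 * y)" by (simp add: dist_norm)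
      qed
      then have "emeasure lborel {z \<in> ball (0::complex) 1. norm (1 - of_real t * z) \<le> y}
          \<le> emeasure lborel (cball (complex_of_real (1 / t)) (2 * y))"
        by (intro emeasure_mono) auto
      then show ?thesis using y by (simp only: disc)
    qed
    then have "ennreal (1 / pi) * emeasure lborel {z \<in> ball (0::complex) 1. norm (1 - of_real t * z) \<le> y}
        \<le> ennreal (1 / pi) * ennreal (pi * (2 * y)\<^sup>2)"
      by (intro mult_left_mono) auto
    also have "\<dots> = ennreal (4 * y\<^sup>2)"
      by (subst ennreal_mult[symmetric]) (auto simp: power_mult_distrib)
    finally show ?thesis unfolding eq .
  qed
qed

lemma kernel_lower_bound:
  assumes "0 \<le> t" "norm z < 1"
  shows "1 - t \<le> norm (1 - of_real t * (z :: complex))"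
proof -
  have "norm (of_real t * z) \<le> t * 1"
    using assms by (simp add: norm_mult mult_left_le)
  then show ?thesis
    using norm_triangle_ineq2[of 1 "of_real t * z"] by simp
qed

lemma kernel_upper_bound:
  assumes "0 \<le> t" "t < 1" "norm z < 1"
  shows "norm (1 - of_real t * (z :: complex)) \<le> 2"
proof -
  have "norm (of_real t * z) \<le> 1 * 1"
    using assms unfolding norm_mult by (intro mult_mono) auto
  then show ?thesis
    using norm_triangle_ineq4[of 1 "of_real t * z"] by simp
qed

text \<open>
  Shells shrinking towards the point \<open>1 / t\<close>: there \<open>2 / |1 - t z|\<close> is
  about \<open>2 ^ j\<close>, and the area \<open>O(4 ^ (- j))\<close> of the shell beats
  \<open>(2 ^ j) powr c\<close> exactly if \<open>c < 2\<close>.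
\<close>

lemma disk_kernel_integral_subcritical:
  assumes c: "c < 2" and t: "0 \<le> t" "t < 1"
  shows "(\<integral>\<^sup>+z. ennreal (norm (1 - of_real t * z) powr (- c)) \<partial>disk_area)
    \<le> ennreal (2 powr (- c) * (2 powr \<bar>c\<bar> * 16 / (1 - 2 powr c * (1 / 4))))"
proof -
  have pos: "0 < norm (1 - of_real t * z)" if "norm z < 1" for z :: complex
    using kernel_lower_bound[OF t(1) that] t by linarith
  have "(\<integral>\<^sup>+z. ennreal ((2 / norm (1 - of_real t * z)) powr c) \<partial>disk_area)
      \<le> ennreal (2 powr \<bar>c\<bar> * 16 / (1 - 2 powr c * (1 / 4)))"
  proof (rule nn_integral_dyadic_bound)
    show "1 \<le> 2 / norm (1 - of_real t * z)" if "z \<in> space disk_area" for z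
      using kernel_upper_bound[OF t, of z] pos[of z] that by simp
    show "emeasure disk_area {z \<in> space disk_area.
        2 ^ j \<le> 2 / norm (1 - of_real t * z) \<and> 2 / norm (1 - of_real t * z) < 2 ^ Suc j}
        \<le> ennreal (16 * (1 / 4) ^ j)" for j
    proof -
      have "emeasure disk_area {z \<in> space disk_area.
          2 ^ j \<le> 2 / norm (1 - of_real t * z) \<and> 2 / norm (1 - of_real t * z) < 2 ^ Suc j}
          \<le> emeasure disk_area {z \<in> ball 0 1. norm (1 - of_real t * z) \<le> 2 / 2 ^ j}"
      proof (rule emeasure_mono)
        show "{z \<in> space disk_area.
          2 ^ j \<le> 2 / norm (1 - of_real t * z) \<and> 2 / norm (1 - of_real t * z) < 2 ^ Suc j}
          \<subseteq> {z \<in> ball 0 1. norm (1 - of_real t * z) \<le> 2 / 2 ^ j}"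
          using pos by (auto simp: field_simps)
        have "{z \<in> space disk_area. norm (1 - of_real t * z) \<le> 2 / 2 ^ j} \<in> sets disk_area"
          by measurable
        then show "{z \<in> ball 0 1. norm (1 - of_real t * z) \<le> 2 / 2 ^ j} \<in> sets disk_area" by simp
      qed
      also have "\<dots> \<le> ennreal (4 * (2 / 2 ^ j)\<^sup>2)"
        by (rule emeasure_disk_area_kernel_sublevel[OF t]) simp
      also have "4 * (2 / 2 ^ j)\<^sup>2 = 16 * (1 / 4 :: real) ^ j"
        by (simp add: power_divide power2_eq_square flip: power_mult_distrib)
      finally show ?thesis .
    qed
    have "2 powr c < 2 powr 2" using c by (intro powr_less_mono) auto
    then show "2 powr c * (1 / 4) < 1" by simp
  qed auto
  then have "ennreal (2 powr (- c)) * (\<integral>\<^sup>+z. ennreal ((2 / norm (1 - of_real t * z)) powr c) \<partial>disk_area)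
      \<le> ennreal (2 powr (- c)) * ennreal (2 powr \<bar>c\<bar> * 16 / (1 - 2 powr c * (1 / 4)))"
    by (intro mult_left_mono) auto
  moreover have "ennreal (2 powr (- c)) * (\<integral>\<^sup>+z. ennreal ((2 / norm (1 - of_real t * z)) powr c) \<partial>disk_area)
    = (\<integral>\<^sup>+z. ennreal (norm (1 - of_real t * z) powr (- c)) \<partial>disk_area)"
    by (subst nn_integral_cmult[symmetric])
       (auto intro!: nn_integral_cong simp: powr_divide powr_minus field_simps simp flip: ennreal_mult)
  ultimately show ?thesis by (simp only: ennreal_mult'[OF powr_ge_zero])
qed

text \<open>
  Since \<open>|1 - t z| \<ge> 1 - t\<close>, one can use shells growing from the scale \<open>1
  - t\<close>: the area is about \<open>(1 - t)\<^sup>2 4 ^ j\<close> and the integrand about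
  \<open>((1 - t) 2 ^ j) powr (- c)\<close>, so that the shells nearest to \<open>1 / t\<close>
  dominate if \<open>c > 2\<close>.
\<close>

lemma disk_kernel_integral_supercritical:
  assumes c: "c > 2" and t: "0 \<le> t" "t < 1"
  shows "(\<integral>\<^sup>+z. ennreal (norm (1 - of_real t * z) powr (- c)) \<partial>disk_area)
    \<le> ennreal (2 powr c * 16 / (1 - 2 powr (- c) * 4) * (1 - t) powr (2 - c))"
proof -
  define \<delta> where "\<delta> = 1 - t"
  have \<delta>: "0 < \<delta>" using t by (simp add: \<delta>_def)
  have "(\<integral>\<^sup>+z. ennreal ((norm (1 - of_real t * z) / \<delta>) powr (- c)) \<partial>disk_area)
      \<le> ennreal (2 powr \<bar>- c\<bar> * (16 * \<delta>\<^sup>2) / (1 - 2 powr (- c) * 4))"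
  proof (rule nn_integral_dyadic_bound)
    show "1 \<le> norm (1 - of_real t * z) / \<delta>" if "z \<in> space disk_area" for z
      using kernel_lower_bound[OF t(1), of z] \<delta> that by (simp add: \<delta>_def)
    show "emeasure disk_area {z \<in> space disk_area.
        2 ^ j \<le> norm (1 - of_real t * z) / \<delta> \<and> norm (1 - of_real t * z) / \<delta> < 2 ^ Suc j}
        \<le> ennreal (16 * \<delta>\<^sup>2 * 4 ^ j)" for j
    proof -
      have "emeasure disk_area {z \<in> space disk_area.
          2 ^ j \<le> norm (1 - of_real t * z) / \<delta> \<and> norm (1 - of_real t * z) / \<delta> < 2 ^ Suc j}
          \<le> emeasure disk_area {z \<in> ball 0 1. norm (1 - of_real t * z) \<le> 2 ^ Suc j * \<delta>}"
      proof (rule emeasure_mono)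
        show "{z \<in> space disk_area.
          2 ^ j \<le> norm (1 - of_real t * z) / \<delta> \<and> norm (1 - of_real t * z) / \<delta> < 2 ^ Suc j}
          \<subseteq> {z \<in> ball 0 1. norm (1 - of_real t * z) \<le> 2 ^ Suc j * \<delta>}"
          using \<delta> by (auto simp: field_simps)
        have "{z \<in> space disk_area. norm (1 - of_real t * z) \<le> 2 ^ Suc j * \<delta>} \<in> sets disk_area"
          by measurable
        then show "{z \<in> ball 0 1. norm (1 - of_real t * z) \<le> 2 ^ Suc j * \<delta>} \<in> sets disk_area" by simp
      qed
      also have "\<dots> \<le> ennreal (4 * (2 ^ Suc j * \<delta>)\<^sup>2)"
        using \<delta> by (intro emeasure_disk_area_kernel_sublevel[OF t]) simp
      also have "4 * (2 ^ Suc j * \<delta>)\<^sup>2 = 16 * \<delta>\<^sup>2 * 4 ^ j"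
        by (simp add: power_mult_distrib power2_eq_square flip: power_mult_distrib)
      finally show ?thesis .
    qed
    have "2 powr (- c) < 2 powr (- 2)" using c by (intro powr_less_mono) auto
    then show "2 powr (- c) * 4 < 1" by (simp add: powr_minus)
  qed auto
  then have "ennreal (\<delta> powr (- c)) * (\<integral>\<^sup>+z. ennreal ((norm (1 - of_real t * z) / \<delta>) powr (- c)) \<partial>disk_area)
      \<le> ennreal (\<delta> powr (- c)) * ennreal (2 powr \<bar>- c\<bar> * (16 * \<delta>\<^sup>2) / (1 - 2 powr (- c) * 4))"
    by (intro mult_left_mono) auto
  also have "\<dots> = ennreal (2 powr c * 16 / (1 - 2 powr (- c) * 4) * \<delta> powr (2 - c))"
    using c \<delta> by (simp add: powr_diff powr_minus field_simps flip: ennreal_mult')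
  finally have "ennreal (\<delta> powr (- c)) * (\<integral>\<^sup>+z. ennreal ((norm (1 - of_real t * z) / \<delta>) powr (- c)) \<partial>disk_area) \<le> \<dots>" .
  moreover have "ennreal (\<delta> powr (- c)) * (\<integral>\<^sup>+z. ennreal ((norm (1 - of_real t * z) / \<delta>) powr (- c)) \<partial>disk_area)
    = (\<integral>\<^sup>+z. ennreal (norm (1 - of_real t * z) powr (- c)) \<partial>disk_area)"
    using \<delta> by (subst nn_integral_cmult[symmetric])
       (auto intro!: nn_integral_cong simp: powr_divide powr_minus field_simps simp flip: ennreal_mult)
  ultimately show ?thesis unfolding \<delta>_def by simp
qed

section \<open>Moments of Carleson measures and the Carleson embedding\<close>

lemma Ico01_space: "borel_measure_Ico01 \<nu> \<Longrightarrow> space \<nu> = {0..<1}"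
  unfolding borel_measure_Ico01_def by (drule sets_eq_imp_space_eq) (simp add: space_restrict_space)

lemma Ico01_measurable:
  assumes "borel_measure_Ico01 \<nu>" "g \<in> borel_measurable borel"
  shows "g \<in> borel_measurable \<nu>"
  using assms(2)
  by (subst measurable_cong_sets[OF assms(1)[unfolded borel_measure_Ico01_def] refl])
     (rule measurable_restrict_space1)

lemma Ico01_sets:
  assumes "borel_measure_Ico01 \<nu>" "0 \<le> a"
  shows "{a..<1} \<in> sets \<nu>"
proof -
  have "{0..<1} \<inter> {a..<1} \<in> sets (restrict_space borel {0..<1::real})"
    unfolding sets_restrict_space by (intro imageI) simp
  moreover have "{0..<1} \<inter> {a..<1} = {a..<1}" using assms(2) by auto
  ultimately show ?thesis using assms(1) by (simp only: borel_measure_Ico01_def)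
qed

lemma carleson_finite:
  assumes "borel_measure_Ico01 \<nu>" "carleson s \<nu>"
  shows "finite_measure \<nu>"
proof
  obtain M where "emeasure \<nu> {0..<1} \<le> ennreal (M * (1 - 0) powr s)"
    using assms(2) unfolding carleson_def by force
  then show "emeasure \<nu> (space \<nu>) \<noteq> \<infinity>"
    using assms(1) by (auto simp: Ico01_space top_unique)
qed

lemma carleson_measure_tail:
  assumes "borel_measure_Ico01 \<nu>" "carleson s \<nu>"
  obtains M where "0 < M" "\<And>t. 0 \<le> t \<Longrightarrow> t < 1 \<Longrightarrow> measure \<nu> {t..<1} \<le> M * (1 - t) powr s"
proof -
  interpret finite_measure \<nu> using assms by (rule carleson_finite)
  from assms(2) obtain M where M: "0 < M"
    "\<And>t. 0 \<le> t \<Longrightarrow> t < 1 \<Longrightarrow> emeasure \<nu> {t..<1} \<le> ennreal (M * (1 - t) powr s)"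
    unfolding carleson_def by blast
  have "measure \<nu> {t..<1} \<le> M * (1 - t) powr s" if "0 \<le> t" "t < 1" for t
    using M(2)[OF that] M(1) by (simp add: emeasure_eq_measure)
  then show ?thesis using M(1) that by blast
qed

lemma carleson_integrable_power:
  assumes "borel_measure_Ico01 \<nu>" "carleson s \<nu>"
  shows "integrable \<nu> (\<lambda>t. t ^ n)"
proof -
  interpret finite_measure \<nu> using assms by (rule carleson_finite)
  have "(\<lambda>t. t ^ n) \<in> borel_measurable \<nu>"
    using assms(1) by (rule Ico01_measurable) simp
  moreover have "norm (t ^ n) \<le> 1" if "t \<in> space \<nu>" for t :: real
    using that Ico01_space[OF assms(1)] by (simp add: power_le_one)
  ultimately show ?thesis by (intro integrable_const_bound[of _ 1] AE_I2)
qed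

lemma moment_nonneg: "borel_measure_Ico01 \<nu> \<Longrightarrow> 0 \<le> moment \<nu> n"
  unfolding moment_def by (intro integral_nonneg_AE AE_I2) (auto simp: Ico01_space)

lemma powr_le_exp:
  fixes x s :: real
  assumes "0 < s" "0 < x"
  shows "x powr s \<le> (2 * s) powr s * exp (x / 2)"
proof -
  have "x / (2 * s) \<le> exp (x / (2 * s))"
    using exp_ge_add_one_self[of "x / (2 * s)"] by linarith
  then have "(x / (2 * s)) powr s \<le> exp (x / (2 * s)) powr s"
    using assms by (intro powr_mono2) auto
  also have "\<dots> = exp (x / 2)" using assms by (simp add: exp_powr_real)
  finally show ?thesis using assms by (simp add: powr_divide field_simps)
qed

text \<open>
  A layer decomposition at the scale \<open>1 / (n + 2)\<close>: on the layer where \<open>(1 -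
  t) * (n + 2)\<close> has integer part \<open>j\<close>, the power \<open>t ^ n\<close> is at
  most \<open>exp (2 - j)\<close>. Bounding by indicators of intervals \<open>{a..<1}\<close>
  prepares for integration against a Carleson measure. The maximum with \<open>0\<close> keeps
  the last intervals inside \<open>[0,1)\<close>.
\<close>

lemma power_le_exp_steps:
  fixes t :: real
  assumes "0 \<le> t" "t < 1"
  shows "t ^ n \<le> (\<Sum>j\<le>n + 2. exp (2 - real j) * indicator {max 0 (1 - (real j + 1) / (real n + 2))..<1} t)"
proof -
  define m where "m = real n + 2"
  define j where "j = nat \<lfloor>(1 - t) * m\<rfloor>"
  have "0 < m" by (simp add: m_def)
  have jl: "real j \<le> (1 - t) * m" and ju: "(1 - t) * m < real j + 1"
    using assms \<open>0 < m\<close> unfolding j_def by (auto simp: of_nat_floor)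
  have "(1 - t) * m \<le> 1 * m" using assms \<open>0 < m\<close> by (intro mult_right_mono) auto
  then have jm: "real j \<le> m" using jl by simp
  then have "j \<le> n + 2" by (simp add: m_def)
  have "t \<le> exp (- real j / m)"
  proof -
    have "real j / m \<le> 1 - t" using jl \<open>0 < m\<close> by (simp add: field_simps)
    then show ?thesis using exp_ge_add_one_self[of "- real j / m"] by simp
  qed
  then have "t ^ n \<le> exp (- real j / m) ^ n" using assms by (intro power_mono) auto
  also have "\<dots> = exp (2 * real j / m - real j)"
    using \<open>0 < m\<close> by (simp add: m_def field_simps flip: exp_of_nat_mult)
  also have "\<dots> \<le> exp (2 - real j)" using jm \<open>0 < m\<close> by (simp add: field_simps)
  also have "\<dots> = exp (2 - real j) * indicator {max 0 (1 - (real j + 1) / m)..<1} t"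
    using assms ju \<open>0 < m\<close> by (simp add: field_simps)
  also have "\<dots> \<le> (\<Sum>j\<le>n + 2. exp (2 - real j) * indicator {max 0 (1 - (real j + 1) / m)..<1} t)"
    using \<open>j \<le> n + 2\<close> by (intro member_le_sum[of j "{..n + 2}"]) auto
  finally show ?thesis by (simp add: m_def)
qed

text \<open>
  The layer at depth \<open>j\<close> has measure \<open>O(((j + 1) / (n + 2)) powr s)\<close>,
  and the weights \<open>exp (- j)\<close> make the sum over the layers converge uniformly in
  \<open>n\<close>.
\<close>

lemma carleson_moment_bound:
  assumes \<nu>: "borel_measure_Ico01 \<nu>" "carleson s \<nu>" and s: "0 < s"
  obtains C where "0 < C" "\<And>n. moment \<nu> n \<le> C * (real n + 2) powr (- s)"
proof -
  interpret finite_measure \<nu> using \<nu> by (rule carleson_finite)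
  obtain M where M: "0 < M" "\<And>t. 0 \<le> t \<Longrightarrow> t < 1 \<Longrightarrow> measure \<nu> {t..<1} \<le> M * (1 - t) powr s"
    using carleson_measure_tail[OF \<nu>] by blast
  \<comment> \<open>half of the decay \<open>exp (- j)\<close> absorbs the growth of \<open>(j + 1) powr
    s\<close>, the other half is summed\<close>
  define q where "q = exp (- (1 / 2) :: real)"
  have q: "0 < q" "q < 1" by (auto simp: q_def)
  define C where "C = M * exp 2 * (2 * s) powr s * exp (1 / 2) * (1 / (1 - q))"
  have "0 < C" using M(1) q s by (simp add: C_def)
  have "moment \<nu> n \<le> C * (real n + 2) powr (- s)" for n
  proof -
    define m where "m = real n + 2"
    have "0 < m" by (simp add: m_def)
    define a where "a = (\<lambda>j. max 0 (1 - (real j + 1) / m))"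
    have a: "0 \<le> a j" "a j < 1" "1 - a j \<le> (real j + 1) / m" for j
      using \<open>0 < m\<close> by (auto simp: a_def add_pos_pos)
    have "moment \<nu> n \<le> (LINT t|\<nu>. (\<Sum>j\<le>n + 2. exp (2 - real j) * indicator {a j..<1} t))"
      unfolding moment_def
    proof (rule integral_mono[OF carleson_integrable_power[OF \<nu>]])
      show "integrable \<nu> (\<lambda>t. \<Sum>j\<le>n + 2. exp (2 - real j) * indicator {a j..<1} t)"
        using a Ico01_sets[OF \<nu>(1)]
        by (intro Bochner_Integration.integrable_sum integrable_mult_right integrable_real_indicator)
           (auto simp: emeasure_eq_measure)
      show "t ^ n \<le> (\<Sum>j\<le>n + 2. exp (2 - real j) * indicator {a j..<1} t)" if "t \<in> space \<nu>" for t
        using power_le_exp_steps[of t n] that Ico01_space[OF \<nu>(1)] by (simp add: a_def m_def)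
    qed
    also have "\<dots> = (\<Sum>j\<le>n + 2. exp (2 - real j) * measure \<nu> {a j..<1})"
      using a Ico01_sets[OF \<nu>(1)]
      by (subst Bochner_Integration.integral_sum)
         (auto simp: emeasure_eq_measure intro!: sum.cong integrable_mult_right integrable_real_indicator)
    also have "\<dots> \<le> (\<Sum>j\<le>n + 2. (M * exp 2 * (2 * s) powr s * exp (1 / 2) * m powr (- s)) * q ^ j)"
    proof (rule sum_mono)
      fix j
      have "measure \<nu> {a j..<1} \<le> M * (1 - a j) powr s" using a by (intro M) auto
      also have "\<dots> \<le> M * ((real j + 1) / m) powr s"
        using a[of j] M s by (intro mult_left_mono powr_mono2) auto
      also have "\<dots> = M * m powr (- s) * (real j + 1) powr s"
        using \<open>0 < m\<close> by (simp add: powr_divide powr_minus field_simps)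
      also have "\<dots> \<le> M * m powr (- s) * ((2 * s) powr s * exp ((real j + 1) / 2))"
        using M s by (intro mult_left_mono powr_le_exp) auto
      finally have "exp (2 - real j) * measure \<nu> {a j..<1}
          \<le> exp (2 - real j) * (M * m powr (- s) * ((2 * s) powr s * exp ((real j + 1) / 2)))"
        by (intro mult_left_mono) auto
      also have "\<dots> = M * (2 * s) powr s * m powr (- s) * (exp (2 - real j) * exp ((real j + 1) / 2))"
        by (simp add: algebra_simps)
      also have "exp (2 - real j) * exp ((real j + 1) / 2) = exp 2 * exp (1 / 2) * q ^ j"
        by (simp add: q_def flip: exp_add exp_of_nat_mult) (simp add: field_simps)
      finally show "exp (2 - real j) * measure \<nu> {a j..<1}
          \<le> (M * exp 2 * (2 * s) powr s * exp (1 / 2) * m powr (- s)) * q ^ j"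
        by (simp add: algebra_simps)
    qed
    also have "\<dots> = (M * exp 2 * (2 * s) powr s * exp (1 / 2) * m powr (- s)) * (\<Sum>j\<le>n + 2. q ^ j)"
      by (rule sum_distrib_left[symmetric])
    also have "\<dots> \<le> (M * exp 2 * (2 * s) powr s * exp (1 / 2) * m powr (- s)) * (1 / (1 - q))"
    proof (rule mult_left_mono)
      have "(\<Sum>j\<le>n + 2. q ^ j) \<le> (\<Sum>j. q ^ j)"
        using q by (intro sum_le_suminf summable_geometric) auto
      then show "(\<Sum>j\<le>n + 2. q ^ j) \<le> 1 / (1 - q)" using q by (simp add: suminf_geometric)
    qed (use M s in auto)
    finally show ?thesis by (simp add: C_def m_def algebra_simps)
  qed
  with \<open>0 < C\<close> show ?thesis using that by blast
qed

lemma moment_antimono: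
  assumes "borel_measure_Ico01 \<nu>" "carleson s \<nu>"
  shows "moment \<nu> (n + k) \<le> moment \<nu> k"
  unfolding moment_def
proof (rule integral_mono)
  fix t assume "t \<in> space \<nu>"
  then have "0 \<le> t" "t < 1" using Ico01_space[OF assms(1)] by auto
  then show "t ^ (n + k) \<le> t ^ k" by (intro power_decreasing) auto
qed (intro carleson_integrable_power[OF assms])+

text \<open>
  The moments decay like \<open>(k + 2) powr (- 2 / p)\<close>, exactly the weight for which the
  coefficients are summable.
\<close>

lemma bergman_carleson_embedding:
  assumes p: "0 < p" "p \<le> 1" and \<nu>: "borel_measure_Ico01 \<nu>" "carleson (2 / p) \<nu>"
  obtains C where "0 < C"
    "\<And>f. f \<in> bergman p \<Longrightarrow> summable (\<lambda>k. norm (taylor_coeff f k) * moment \<nu> k)"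
    "\<And>f. f \<in> bergman p \<Longrightarrow> (\<Sum>k. norm (taylor_coeff f k) * moment \<nu> k) \<le> C * bergman_norm p f"
proof -
  have "0 < 2 / p" using p by simp
  from carleson_moment_bound[OF \<nu> this] obtain C1 where C1: "0 < C1"
    "\<And>n. moment \<nu> n \<le> C1 * (real n + 2) powr (- (2 / p))" by blast
  define C2 where "C2 = 4 * exp 2 * (2 powr (2 / p\<^sup>2)) powr (1 - p)"
  have "0 < C2" by (simp add: C2_def)
  have le: "norm (taylor_coeff f k) * moment \<nu> k
      \<le> C1 * (norm (taylor_coeff f k) * (real k + 2) powr (- (2 / p)))" for f k
    using mult_left_mono[OF C1(2)[of k] norm_ge_zero[of "taylor_coeff f k"]] by (simp add: algebra_simps)
  have sm: "summable (\<lambda>k. norm (taylor_coeff f k) * moment \<nu> k)" if "f \<in> bergman p" for f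
    by (rule summable_comparison_test'[OF summable_mult[OF bergman_coeff_sum(1)[OF p that], of C1]])
       (use le[of f] in \<open>simp add: moment_nonneg[OF \<nu>(1)]\<close>)
  have "(\<Sum>k. norm (taylor_coeff f k) * moment \<nu> k) \<le> (C1 * C2) * bergman_norm p f"
    if "f \<in> bergman p" for f
  proof -
    have "(\<Sum>k. norm (taylor_coeff f k) * moment \<nu> k)
        \<le> (\<Sum>k. C1 * (norm (taylor_coeff f k) * (real k + 2) powr (- (2 / p))))"
      by (intro suminf_le le sm that summable_mult bergman_coeff_sum(1) p)
    also have "\<dots> = C1 * (\<Sum>k. norm (taylor_coeff f k) * (real k + 2) powr (- (2 / p)))"
      by (intro suminf_mult bergman_coeff_sum(1) p that)
    also have "\<dots> \<le> C1 * (C2 * bergman_norm p f)"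
      unfolding C2_def using C1 by (intro mult_left_mono bergman_coeff_sum(2) p that) auto
    finally show ?thesis by simp
  qed
  with C1(1) \<open>0 < C2\<close> sm show ?thesis using that[of "C1 * C2"] by auto
qed

text \<open>
  Dominated convergence for the Taylor series of \<open>f\<close> along the radius
  \<open>[0,1)\<close>: the sum of the integrals of \<open>|a k| t ^ (n + k)\<close> is at most
  the sum of \<open>|a k|\<close> times the \<open>k\<close>-th moments, for every
  \<open>n\<close>.
\<close>

lemma moment_coeff_sums:
  assumes \<nu>: "borel_measure_Ico01 \<nu>" "carleson s \<nu>" and holf: "f holomorphic_on ball 0 1"
    and sm: "summable (\<lambda>k. norm (taylor_coeff f k) * moment \<nu> k)"
  shows "integrable \<nu> (\<lambda>t. of_real t ^ n * f (of_real t))"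
    and "summable (\<lambda>k. norm (of_real (moment \<nu> (n + k)) * taylor_coeff f k))"
    and "(\<lambda>k. of_real (moment \<nu> (n + k)) * taylor_coeff f k) sums (LINT t|\<nu>. of_real t ^ n * f (of_real t))"
    and "(LINT t|\<nu>. norm (of_real t ^ n * f (of_real t))) \<le> (\<Sum>k. norm (taylor_coeff f k) * moment \<nu> k)"
proof -
  define a where "a = taylor_coeff f"
  define g where "g = (\<lambda>k t. a k * of_real (t ^ (n + k)))"
  have sp: "space \<nu> = {0..<1}" by (rule Ico01_space[OF \<nu>(1)])
  have intg: "integrable \<nu> (g k)" for k
    unfolding g_def using carleson_integrable_power[OF \<nu>, of "n + k"]
    by (intro integrable_mult_right integrable_of_real)
  have G: "integral\<^sup>L \<nu> (g k) = of_real (moment \<nu> (n + k)) * a k" for k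
    unfolding g_def moment_def by (simp add: mult.commute del: of_real_power)
  have Gn: "(LINT t|\<nu>. norm (g k t)) = norm (a k) * moment \<nu> (n + k)" for k
  proof -
    have "(LINT t|\<nu>. norm (g k t)) = (LINT t|\<nu>. norm (a k) * t ^ (n + k))"
      by (rule Bochner_Integration.integral_cong) (auto simp: g_def norm_mult norm_power sp)
    then show ?thesis by (simp add: moment_def)
  qed
  have le: "norm (a k) * moment \<nu> (n + k) \<le> norm (a k) * moment \<nu> k" for k
    by (intro mult_left_mono moment_antimono[OF \<nu>]) auto
  have sn: "summable (\<lambda>k. norm (a k) * moment \<nu> (n + k))"
  proof (rule summable_comparison_test'[OF sm])
    fix k
    have "norm (norm (a k) * moment \<nu> (n + k)) = norm (a k) * moment \<nu> (n + k)"
      using moment_nonneg[OF \<nu>(1)] by (simp add: abs_mult)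
    then show "norm (norm (a k) * moment \<nu> (n + k)) \<le> norm (taylor_coeff f k) * moment \<nu> k"
      using le[of k] by (simp only: a_def)
  qed
  have "norm (of_real (moment \<nu> (n + k)) * taylor_coeff f k) = norm (a k) * moment \<nu> (n + k)" for k
    using moment_nonneg[OF \<nu>(1), of "n + k"] by (simp add: norm_mult a_def)
  with sn show "summable (\<lambda>k. norm (of_real (moment \<nu> (n + k)) * taylor_coeff f k))"
    by (simp only:)
  have gs: "(\<lambda>k. g k t) sums (of_real t ^ n * f (of_real t))" if "t \<in> space \<nu>" for t
  proof -
    have "(\<lambda>k. of_real t ^ n * (a k * of_real t ^ k)) sums (of_real t ^ n * f (of_real t))"
      unfolding a_def using that by (intro sums_mult taylor_sums holf) (auto simp: sp)
    then show ?thesis by (simp add: g_def power_add algebra_simps)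
  qed
  have AE: "AE t in \<nu>. summable (\<lambda>k. norm (g k t))"
  proof (rule AE_I2)
    fix t assume t: "t \<in> space \<nu>"
    then have t': "0 \<le> t" "t < 1" by (auto simp: sp)
    obtain u where u: "t < u" "u < 1" using dense[OF t'(2)] by blast
    have "summable (\<lambda>k. a k * of_real u ^ k)"
      unfolding a_def using t' u by (intro sums_summable[OF taylor_sums[OF holf]]) simp
    from powser_insidea[OF this, of "of_real t"]
    have "summable (\<lambda>k. norm (a k * of_real t ^ k))"
      using t' u by simp
    from summable_mult[OF this, of "norm (of_real t ^ n :: complex)"]
    show "summable (\<lambda>k. norm (g k t))"
      by (simp add: g_def norm_mult norm_power power_add algebra_simps)
  qed
  have sI: "summable (\<lambda>k. LINT t|\<nu>. norm (g k t))" unfolding Gn by (rule sn)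
  have cong: "(\<Sum>k. g k t) = of_real t ^ n * f (of_real t)" if "t \<in> space \<nu>" for t
    using gs[OF that] by (simp add: sums_iff)
  have int_iff: "integrable \<nu> (\<lambda>t. \<Sum>k. g k t) \<longleftrightarrow> integrable \<nu> (\<lambda>t. of_real t ^ n * f (of_real t))"
    by (rule Bochner_Integration.integrable_cong) (auto simp: cong)
  show int: "integrable \<nu> (\<lambda>t. of_real t ^ n * f (of_real t))"
    using integrable_suminf[OF intg AE sI] int_iff by simp
  have "(LINT t|\<nu>. (\<Sum>k. g k t)) = (LINT t|\<nu>. of_real t ^ n * f (of_real t))"
    by (rule Bochner_Integration.integral_cong) (auto simp: cong)
  then show "(\<lambda>k. of_real (moment \<nu> (n + k)) * taylor_coeff f k) sums (LINT t|\<nu>. of_real t ^ n * f (of_real t))"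
    using sums_integral[OF intg AE sI] by (simp add: G a_def)
  have AE': "AE t in \<nu>. summable (\<lambda>k. norm (norm (g k t)))" using AE by simp
  have sI': "summable (\<lambda>k. LINT t|\<nu>. norm (norm (g k t)))" using sI by simp
  have "(LINT t|\<nu>. norm (of_real t ^ n * f (of_real t))) \<le> (LINT t|\<nu>. (\<Sum>k. norm (g k t)))"
  proof (rule integral_mono_AE)
    show "integrable \<nu> (\<lambda>t. norm (of_real t ^ n * f (of_real t)))" using int by simp
    show "integrable \<nu> (\<lambda>t. \<Sum>k. norm (g k t))"
      using integrable_suminf[OF integrable_norm[OF intg] AE' sI'] .
    show "AE t in \<nu>. norm (of_real t ^ n * f (of_real t)) \<le> (\<Sum>k. norm (g k t))"
      using AE AE_space by eventually_elim (auto simp: cong[symmetric] summable_norm)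
  qed
  also have "\<dots> = (\<Sum>k. norm (a k) * moment \<nu> (n + k))"
    using integral_suminf[OF integrable_norm[OF intg] AE' sI'] by (simp add: Gn)
  also have "\<dots> \<le> (\<Sum>k. norm (a k) * moment \<nu> k)"
    using le sn sm by (intro suminf_le) (auto simp: a_def)
  finally show "(LINT t|\<nu>. norm (of_real t ^ n * f (of_real t))) \<le> (\<Sum>k. norm (taylor_coeff f k) * moment \<nu> k)"
    by (simp add: a_def)
qed

section \<open>Integral representation of the generalized Hilbert operator\<close>

text \<open>
  The Taylor coefficients of \<open>(1 - x) powr (- (\<alpha> + 1))\<close> at \<open>0\<close>.
\<close>

definition hilbert_weight :: "real \<Rightarrow> nat \<Rightarrow> real" where
  "hilbert_weight \<alpha> n = Gamma (real n + 1 + \<alpha>) / (Gamma (real n + 1) * Gamma (\<alpha> + 1))"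

lemma hilbert_weight_nonneg: "-1 < \<alpha> \<Longrightarrow> 0 \<le> hilbert_weight \<alpha> n"
  unfolding hilbert_weight_def
  by (intro divide_nonneg_nonneg mult_nonneg_nonneg Gamma_real_nonneg) auto

lemma hilbert_weight_eq_gbinomial:
  assumes "-1 < \<alpha>"
  shows "hilbert_weight \<alpha> n = (\<alpha> + 1 + real n - 1) gchoose n"
proof -
  have "\<alpha> + 1 \<notin> \<int>\<^sub>\<le>\<^sub>0" using assms by (auto elim!: nonpos_Ints_cases)
  then have "pochhammer (\<alpha> + 1) n = Gamma (\<alpha> + 1 + real n) / Gamma (\<alpha> + 1)"
    by (rule pochhammer_Gamma)
  moreover have "(\<alpha> + 1 + real n - 1) gchoose n = pochhammer (\<alpha> + 1) n / fact n"
    by (simp add: gbinomial_pochhammer')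
  moreover have "Gamma (real n + 1) = fact n"
    using Gamma_fact[of n, where 'a = real] by (simp add: add.commute)
  ultimately show ?thesis
    by (simp add: hilbert_weight_def add_ac mult.commute)
qed

lemma hilbert_weight_sums:
  fixes w :: complex
  assumes "-1 < \<alpha>" "norm w < 1"
  shows "(\<lambda>n. of_real (hilbert_weight \<alpha> n) * w ^ n) sums ((1 - w) powr of_real (- (\<alpha> + 1)))"
proof -
  have "of_real (hilbert_weight \<alpha> n) * w ^ n
      = (- 1) ^ n * ((complex_of_real (\<alpha> + 1) + of_nat n - 1) gchoose n) * (- w) ^ n" for n
  proof -
    have "of_real (hilbert_weight \<alpha> n) = ((complex_of_real (\<alpha> + 1) + of_nat n - 1) gchoose n)"
      unfolding hilbert_weight_eq_gbinomial[OF assms(1)]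
      by (simp add: gbinomial_prod_rev)
    moreover have "(- w) ^ n = (- 1) ^ n * w ^ n" by (rule power_minus)
    ultimately show ?thesis by (simp add: power_mult_distrib[symmetric] mult.left_commute)
  qed
  then show ?thesis
    using one_plus_neg_powr_powser[of "- w" "of_real (\<alpha> + 1)"] assms(2) by simp
qed

lemma hilbert_weight_summable:
  assumes "-1 < \<alpha>" "0 \<le> r" "r < 1"
  shows "summable (\<lambda>n. hilbert_weight \<alpha> n * r ^ n)"
proof -
  have "summable (\<lambda>n. complex_of_real (hilbert_weight \<alpha> n * r ^ n))"
    using hilbert_weight_sums[OF assms(1), of "of_real r"] assms by (simp add: sums_iff)
  then show ?thesis by (simp only: summable_of_real_iff)
qed

text \<open>
  Interchange of \<open>\<Sum>n\<close> and \<open>\<integral> d\<mu>\<close>: the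
  \<open>n\<close>-th term has \<open>L\<^sup>1\<close> norm at most a constant times the
  \<open>n\<close>-th weight times \<open>|z| ^ n\<close>, and the weights have radius of
  convergence \<open>1\<close>.
\<close>

lemma hilbert_op_integral_representation:
  assumes \<mu>: "borel_measure_Ico01 \<mu>" "carleson s \<mu>" and holf: "f holomorphic_on ball 0 1"
    and sm: "summable (\<lambda>k. norm (taylor_coeff f k) * moment \<mu> k)" and \<alpha>: "-1 < \<alpha>"
  shows "hilbert_op_defined \<mu> \<alpha> f"
    and "hilbert_op \<mu> \<alpha> f holomorphic_on ball 0 1"
    and "norm z < 1 \<Longrightarrow> integrable \<mu> (\<lambda>t. f (of_real t) * (1 - of_real t * z) powr of_real (- (\<alpha> + 1)))"
    and "norm z < 1 \<Longrightarrow> hilbert_op \<mu> \<alpha> f z =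
      (LINT t|\<mu>. f (of_real t) * (1 - of_real t * z) powr of_real (- (\<alpha> + 1)))"
proof -
  have sp: "space \<mu> = {0..<1}" by (rule Ico01_space[OF \<mu>(1)])
  note mc = moment_coeff_sums[OF \<mu> holf sm]
  define I where "I = (\<lambda>n. LINT t|\<mu>. of_real t ^ n * f (of_real t))"
  define A where "A = (\<Sum>k. norm (taylor_coeff f k) * moment \<mu> k)"
  have coeff: "hilbert_coeff \<mu> \<alpha> f n = of_real (hilbert_weight \<alpha> n) * I n" for n
    using mc(3)[of n] by (simp add: hilbert_coeff_def hilbert_weight_def I_def sums_iff)
  define h where "h = (\<lambda>z n t. of_real (hilbert_weight \<alpha> n) * z ^ n * (of_real t ^ n * f (of_real t)))"
  have inth: "integrable \<mu> (h z n)" for z n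
    unfolding h_def by (intro integrable_mult_right mc(1))
  have I: "integral\<^sup>L \<mu> (h z n) = hilbert_coeff \<mu> \<alpha> f n * z ^ n" for z n
    unfolding h_def integral_mult_right_zero coeff I_def by simp
  have nn: "0 \<le> hilbert_weight \<alpha> n" for n by (rule hilbert_weight_nonneg[OF \<alpha>])
  have nh: "norm (h z n t) = hilbert_weight \<alpha> n * norm z ^ n * norm (of_real t ^ n * f (of_real t))" for z n t
    using nn[of n] by (simp add: h_def norm_mult norm_power)
  have sI: "summable (\<lambda>n. LINT t|\<mu>. norm (h z n t))" if "norm z < 1" for z
  proof (rule summable_comparison_test'[OF summable_mult2[OF hilbert_weight_summable[OF \<alpha> norm_ge_zero that], of A]])
    fix n
    have "(LINT t|\<mu>. norm (h z n t))
        = hilbert_weight \<alpha> n * norm z ^ n * (LINT t|\<mu>. norm (of_real t ^ n * f (of_real t)))"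
      by (simp only: nh integral_mult_right_zero)
    also have "\<dots> \<le> hilbert_weight \<alpha> n * norm z ^ n * A"
      unfolding A_def using nn[of n] by (intro mult_left_mono mc(4)) auto
    finally show "norm (LINT t|\<mu>. norm (h z n t)) \<le> hilbert_weight \<alpha> n * norm z ^ n * A"
      by (simp add: integral_nonneg_AE)
  qed
  have AE: "AE t in \<mu>. summable (\<lambda>n. norm (h z n t))" if "norm z < 1" for z
  proof (rule AE_I2)
    fix t assume t: "t \<in> space \<mu>"
    show "summable (\<lambda>n. norm (h z n t))"
    proof (rule summable_comparison_test'[OF summable_mult2[OF hilbert_weight_summable[OF \<alpha> norm_ge_zero that], of "norm (f (of_real t))"]])
      fix n
      have "norm (of_real t ^ n * f (of_real t)) \<le> 1 * norm (f (of_real t))"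
        unfolding norm_mult using t by (intro mult_right_mono) (auto simp: sp norm_power power_le_one)
      then show "norm (norm (h z n t)) \<le> hilbert_weight \<alpha> n * norm z ^ n * norm (f (of_real t))"
        unfolding real_norm_def abs_norm_cancel nh using nn[of n] by (simp add: mult_left_mono abs_mult)
    qed
  qed
  have cong: "(\<Sum>n. h z n t) = f (of_real t) * (1 - of_real t * z) powr of_real (- (\<alpha> + 1))"
    if "norm z < 1" "t \<in> space \<mu>" for z t
  proof -
    have "norm (of_real t * z) < 1"
    proof -
      have "norm (of_real t * z) \<le> 1 * norm z"
        unfolding norm_mult using that by (intro mult_right_mono) (auto simp: sp)
      then show ?thesis using that by simp
    qed
    from sums_mult[OF hilbert_weight_sums[OF \<alpha> this], of "f (of_real t)"]
    have "(\<lambda>n. h z n t) sums (f (of_real t) * (1 - of_real t * z) powr of_real (- (\<alpha> + 1)))"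
      unfolding h_def power_mult_distrib by (simp only: mult_ac)
    then show ?thesis by (simp add: sums_iff)
  qed
  have sm_op: "(\<lambda>n. hilbert_coeff \<mu> \<alpha> f n * z ^ n) sums (LINT t|\<mu>. (\<Sum>n. h z n t))" if "norm z < 1" for z
    using sums_integral[OF inth AE[OF that] sI[OF that]] unfolding I .
  show "hilbert_op_defined \<mu> \<alpha> f"
    unfolding hilbert_op_defined_def
    using sums_summable[OF mc(3)] sums_summable[OF sm_op] by auto
  show rep: "hilbert_op \<mu> \<alpha> f z =
      (LINT t|\<mu>. f (of_real t) * (1 - of_real t * z) powr of_real (- (\<alpha> + 1)))" if "norm z < 1"
  proof -
    have "hilbert_op \<mu> \<alpha> f z = (LINT t|\<mu>. (\<Sum>n. h z n t))"
      unfolding hilbert_op_def using sums_unique[OF sm_op[OF that]] by simp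
    also have "\<dots> = (LINT t|\<mu>. f (of_real t) * (1 - of_real t * z) powr of_real (- (\<alpha> + 1)))"
      by (rule Bochner_Integration.integral_cong) (auto simp: cong[OF that])
    finally show ?thesis .
  qed
  show "integrable \<mu> (\<lambda>t. f (of_real t) * (1 - of_real t * z) powr of_real (- (\<alpha> + 1)))" if "norm z < 1"
  proof -
    have "integrable \<mu> (\<lambda>t. (\<Sum>n. h z n t))"
      by (rule integrable_suminf[OF inth AE[OF that] sI[OF that]])
    also have "?this \<longleftrightarrow> ?thesis"
      by (rule Bochner_Integration.integrable_cong) (auto simp: cong[OF that])
    finally show ?thesis .
  qed
  have "(\<lambda>n. hilbert_coeff \<mu> \<alpha> f n * (w - 0) ^ n) sums hilbert_op \<mu> \<alpha> f w" if "w \<in> ball 0 1" for w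
    using sm_op[of w] that unfolding hilbert_op_def by (auto simp: sums_iff)
  then show "hilbert_op \<mu> \<alpha> f holomorphic_on ball 0 1"
    by (rule power_series_holomorphic)
qed

lemma Ico01_measurable_holomorphic:
  assumes "borel_measure_Ico01 \<mu>" "f holomorphic_on ball 0 1"
  shows "(\<lambda>t. f (complex_of_real t)) \<in> borel_measurable \<mu>"
proof -
  have "continuous_on (complex_of_real ` {0..<1}) f"
    using holomorphic_on_imp_continuous_on[OF assms(2)] by (rule continuous_on_subset) auto
  then have "continuous_on {0..<1} (\<lambda>t. f (complex_of_real t))"
    by (rule continuous_on_compose2) (auto intro!: continuous_intros)
  from borel_measurable_continuous_on_restrict[OF this] show ?thesis
    by (subst measurable_cong_sets[OF assms(1)[unfolded borel_measure_Ico01_def] refl])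
qed

lemma finite_measure_disk_area: "finite_measure disk_area"
proof
  have "emeasure disk_area (space disk_area) = ennreal (1 / pi) * emeasure lborel (ball (0::complex) 1)"
    by (subst emeasure_disk_area) auto
  also have "\<dots> < \<infinity>"
    using emeasure_lborel_ball_finite[of "0::complex" 1] by (simp add: ennreal_mult_less_top)
  finally show "emeasure disk_area (space disk_area) \<noteq> \<infinity>" by simp
qed

lemma norm_kernel_powr:
  "norm (w powr complex_of_real r) = norm w powr r"
  by (simp add: norm_powr_real_powr')

text \<open>
  Tonelli's theorem applied to the integral representation.
\<close>

lemma nn_integral_hilbert_op_le:
  assumes \<mu>: "borel_measure_Ico01 \<mu>" "carleson s \<mu>" and holf: "f holomorphic_on ball 0 1"
    and sm: "summable (\<lambda>k. norm (taylor_coeff f k) * moment \<mu> k)" and \<alpha>: "-1 < \<alpha>"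
  shows "(\<integral>\<^sup>+z. ennreal (norm (hilbert_op \<mu> \<alpha> f z)) \<partial>disk_area)
    \<le> (\<integral>\<^sup>+t. ennreal (norm (f (of_real t))) *
          (\<integral>\<^sup>+z. ennreal (norm (1 - of_real t * z) powr (- (\<alpha> + 1))) \<partial>disk_area) \<partial>\<mu>)"
proof -
  interpret M: finite_measure \<mu> by (rule carleson_finite[OF \<mu>])
  interpret D: finite_measure disk_area by (rule finite_measure_disk_area)
  interpret P: pair_sigma_finite disk_area \<mu> ..
  have [measurable]: "(\<lambda>t. f (complex_of_real t)) \<in> borel_measurable \<mu>"
    by (rule Ico01_measurable_holomorphic[OF \<mu>(1) holf])
  have [measurable]: "(\<lambda>t. complex_of_real t) \<in> borel_measurable \<mu>"
    by (rule Ico01_measurable[OF \<mu>(1)]) simp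
  let ?k = "\<lambda>z t. ennreal (norm (f (of_real t)) * norm (1 - of_real t * z) powr (- (\<alpha> + 1)))"
  have m: "case_prod ?k \<in> borel_measurable (disk_area \<Otimes>\<^sub>M \<mu>)"
  proof -
    have [measurable]: "(\<lambda>x. fst x) \<in> borel_measurable (disk_area \<Otimes>\<^sub>M \<mu>)"
      by (rule measurable_compose[OF measurable_fst id_measurable_disk_area])
    have [measurable]: "(\<lambda>x. complex_of_real (snd x)) \<in> borel_measurable (disk_area \<Otimes>\<^sub>M \<mu>)"
      "(\<lambda>x. f (complex_of_real (snd x))) \<in> borel_measurable (disk_area \<Otimes>\<^sub>M \<mu>)"
      by measurable
    show ?thesis unfolding case_prod_beta by measurable
  qed
  have "(\<integral>\<^sup>+z. ennreal (norm (hilbert_op \<mu> \<alpha> f z)) \<partial>disk_area)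
      \<le> (\<integral>\<^sup>+z. \<integral>\<^sup>+t. ?k z t \<partial>\<mu> \<partial>disk_area)"
  proof (rule nn_integral_mono)
    fix z assume "z \<in> space disk_area"
    then have z: "norm z < 1" by simp
    note rep = hilbert_op_integral_representation(3,4)[OF \<mu> holf sm \<alpha> z]
    show "ennreal (norm (hilbert_op \<mu> \<alpha> f z)) \<le> (\<integral>\<^sup>+t. ?k z t \<partial>\<mu>)"
      unfolding rep(2)
      using integral_norm_bound_ennreal[OF rep(1)] by (simp only: norm_mult norm_kernel_powr)
  qed
  also have "\<dots> = (\<integral>\<^sup>+t. \<integral>\<^sup>+z. ?k z t \<partial>disk_area \<partial>\<mu>)"
    by (rule P.Fubini'[OF m, symmetric])
  also have "\<dots> = (\<integral>\<^sup>+t. ennreal (norm (f (of_real t))) *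
      (\<integral>\<^sup>+z. ennreal (norm (1 - of_real t * z) powr (- (\<alpha> + 1))) \<partial>disk_area) \<partial>\<mu>)"
    by (intro nn_integral_cong, subst nn_integral_cmult[symmetric]) (auto simp: ennreal_mult)
  finally show ?thesis .
qed

section \<open>Boundedness on Bergman spaces\<close>

lemma carleson_mono:
  assumes "carleson s \<mu>" "s' \<le> s"
  shows "carleson s' \<mu>"
proof -
  from assms(1) obtain M where M: "0 < M"
    "\<And>t. 0 \<le> t \<Longrightarrow> t < 1 \<Longrightarrow> emeasure \<mu> {t..<1} \<le> ennreal (M * (1 - t) powr s)"
    unfolding carleson_def by blast
  have "emeasure \<mu> {t..<1} \<le> ennreal (M * (1 - t) powr s')" if t: "0 \<le> t" "t < 1" for t
  proof -
    have "(1 - t) powr s \<le> (1 - t) powr s'" using t assms(2) by (intro powr_mono') auto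
    then have "ennreal (M * (1 - t) powr s) \<le> ennreal (M * (1 - t) powr s')"
      using M(1) by (intro ennreal_leI mult_left_mono) auto
    with M(2)[OF t] show ?thesis by (rule order_trans)
  qed
  with M(1) show ?thesis unfolding carleson_def by blast
qed

text \<open>
  For \<open>b > 0\<close> the weight blows up near \<open>1\<close>, but on the dyadic piece of
  \<open>[t,1)\<close> at distance about \<open>2 ^ (- j) (1 - t)\<close> from \<open>1\<close>
  the measure compensates it, leaving \<open>2 powr (- j s) (1 - t) powr s\<close>.
\<close>

lemma carleson_density:
  assumes \<mu>: "borel_measure_Ico01 \<mu>" "carleson (s + b) \<mu>" and s: "0 < s"
  shows "carleson s (density \<mu> (\<lambda>t. ennreal ((1 - t) powr (- b))))"
proof -
  have sp: "space \<mu> = {0..<1}" by (rule Ico01_space[OF \<mu>(1)])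
  from \<mu>(2) obtain M where M: "0 < M"
    "\<And>t. 0 \<le> t \<Longrightarrow> t < 1 \<Longrightarrow> emeasure \<mu> {t..<1} \<le> ennreal (M * (1 - t) powr (s + b))"
    unfolding carleson_def by blast
  define q where "q = 2 powr (- (s + b))"
  have q: "0 \<le> q" "2 powr b * q < 1"
  proof -
    have "2 powr b * q = 2 powr (- s)" by (simp add: q_def flip: powr_add)
    also have "\<dots> < 2 powr 0" using s by (intro powr_less_mono) auto
    finally show "2 powr b * q < 1" by simp
  qed (simp add: q_def)
  define K where "K = 2 powr \<bar>b\<bar> * M / (1 - 2 powr b * q)"
  have "0 < K" using M q by (simp add: K_def)
  have [measurable]: "(\<lambda>u. u) \<in> borel_measurable \<mu>" by (rule Ico01_measurable[OF \<mu>(1)]) simp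
  have "emeasure (density \<mu> (\<lambda>t. ennreal ((1 - t) powr (- b)))) {t..<1} \<le> ennreal (K * (1 - t) powr s)"
    if t: "0 \<le> t" "t < 1" for t
  proof -
    define \<delta> where "\<delta> = 1 - t"
    have \<delta>: "0 < \<delta>" using t by (simp add: \<delta>_def)
    define N where "N = restrict_space \<mu> {t..<1}"
    have tS: "{t..<1} \<inter> space \<mu> \<in> sets \<mu>"
      using Ico01_sets[OF \<mu>(1) t(1)] by (intro sets.Int) auto
    have spN: "space N = {t..<1}" using t by (auto simp: N_def space_restrict_space sp)
    have mN: "(\<lambda>u. \<delta> / (1 - u)) \<in> borel_measurable N"
      unfolding N_def by (rule measurable_restrict_space1) measurable
    have main: "(\<integral>\<^sup>+u. ennreal ((\<delta> / (1 - u)) powr b) \<partial>N)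
        \<le> ennreal (2 powr \<bar>b\<bar> * (M * \<delta> powr (s + b)) / (1 - 2 powr b * q))"
    proof (rule nn_integral_dyadic_bound[OF mN])
      show "1 \<le> \<delta> / (1 - u)" if "u \<in> space N" for u
        using that by (simp add: spN \<delta>_def)
      show "emeasure N {u \<in> space N. 2 ^ j \<le> \<delta> / (1 - u) \<and> \<delta> / (1 - u) < 2 ^ Suc j}
          \<le> ennreal (M * \<delta> powr (s + b) * q ^ j)" for j
      proof -
        define a where "a = 1 - \<delta> / 2 ^ j"
        have "\<delta> / 2 ^ j \<le> \<delta>" using \<delta> by (simp add: field_simps)
        then have "1 - \<delta> \<le> a" unfolding a_def by simp
        then have a: "0 \<le> a" "a < 1" using \<delta> t by (simp_all add: \<delta>_def, simp add: a_def \<delta>_def)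
        have sub: "{u \<in> space N. 2 ^ j \<le> \<delta> / (1 - u) \<and> \<delta> / (1 - u) < 2 ^ Suc j} \<subseteq> {a..<1}"
          by (auto simp: spN a_def field_simps)
        have "{u \<in> space N. 2 ^ j \<le> \<delta> / (1 - u) \<and> \<delta> / (1 - u) < 2 ^ Suc j} \<subseteq> {t..<1}"
          by (auto simp: spN)
        then have "emeasure N {u \<in> space N. 2 ^ j \<le> \<delta> / (1 - u) \<and> \<delta> / (1 - u) < 2 ^ Suc j}
            = emeasure \<mu> {u \<in> space N. 2 ^ j \<le> \<delta> / (1 - u) \<and> \<delta> / (1 - u) < 2 ^ Suc j}"
          unfolding N_def using tS by (intro emeasure_restrict_space) auto
        also have "\<dots> \<le> emeasure \<mu> {a..<1}"
          by (intro emeasure_mono sub Ico01_sets[OF \<mu>(1)] a)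
        also have "\<dots> \<le> ennreal (M * (1 - a) powr (s + b))" by (rule M(2)[OF a])
        also have "(1 - a) powr (s + b) = \<delta> powr (s + b) * q ^ j"
        proof -
          have "q ^ j = (2 ^ j) powr (- (s + b))"
            by (simp add: q_def powr_powr mult.commute flip: powr_realpow)
          moreover have "(\<delta> / 2 ^ j) powr (s + b) = \<delta> powr (s + b) * (2 ^ j) powr (- (s + b))"
            using \<delta> by (subst powr_divide) (auto simp del: minus_add_distrib simp add: powr_minus_divide)
          ultimately show ?thesis by (simp only: a_def diff_diff_eq2 add_diff_cancel_left')
        qed
        finally show ?thesis by (simp add: mult.assoc)
      qed
    qed (use M q in auto)
    have "emeasure (density \<mu> (\<lambda>t. ennreal ((1 - t) powr (- b)))) {t..<1}
        = (\<integral>\<^sup>+u. ennreal ((1 - u) powr (- b)) * indicator {t..<1} u \<partial>\<mu>)"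
      using Ico01_sets[OF \<mu>(1) t(1)] by (intro emeasure_density) auto
    also have "\<dots> = (\<integral>\<^sup>+u. ennreal ((1 - u) powr (- b)) \<partial>N)"
      unfolding N_def using tS by (rule nn_integral_restrict_space[symmetric])
    also have "\<dots> = (\<integral>\<^sup>+u. ennreal (\<delta> powr (- b)) * ennreal ((\<delta> / (1 - u)) powr b) \<partial>N)"
    proof (rule nn_integral_cong)
      fix u assume "u \<in> space N"
      then have "(1 - u) powr (- b) = \<delta> powr (- b) * (\<delta> / (1 - u)) powr b"
        using \<delta> by (simp add: spN powr_divide powr_minus field_simps)
      then show "ennreal ((1 - u) powr (- b)) = ennreal (\<delta> powr (- b)) * ennreal ((\<delta> / (1 - u)) powr b)"
        by (simp add: ennreal_mult)
    qed
    also have "\<dots> = ennreal (\<delta> powr (- b)) * (\<integral>\<^sup>+u. ennreal ((\<delta> / (1 - u)) powr b) \<partial>N)"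
    proof (rule nn_integral_cmult)
      show "(\<lambda>u. ennreal ((\<delta> / (1 - u)) powr b)) \<in> borel_measurable N"
        unfolding N_def by (rule measurable_restrict_space1) measurable
    qed
    also have "\<dots> \<le> ennreal (\<delta> powr (- b)) * ennreal (2 powr \<bar>b\<bar> * (M * \<delta> powr (s + b)) / (1 - 2 powr b * q))"
      by (intro mult_left_mono main) auto
    also have "\<dots> = ennreal (\<delta> powr (- b) * (2 powr \<bar>b\<bar> * (M * \<delta> powr (s + b)) / (1 - 2 powr b * q)))"
      by (rule ennreal_mult'[symmetric]) simp
    also have "\<delta> powr (- b) * (2 powr \<bar>b\<bar> * (M * \<delta> powr (s + b)) / (1 - 2 powr b * q))
        = K * (\<delta> powr (- b) * \<delta> powr (s + b))"
      by (simp add: K_def)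
    also have "\<delta> powr (- b) * \<delta> powr (s + b) = \<delta> powr s"
      using \<delta> by (simp flip: powr_add)
    finally show ?thesis by (simp add: \<delta>_def)
  qed
  with \<open>0 < K\<close> show ?thesis unfolding carleson_def by blast
qed

lemma nn_integral_carleson_embedding:
  assumes p: "0 < p" "p \<le> 1" and \<nu>: "borel_measure_Ico01 \<nu>" "carleson (2 / p) \<nu>"
  obtains C where "0 < C"
    "\<And>f. f \<in> bergman p \<Longrightarrow> (\<integral>\<^sup>+t. ennreal (norm (f (of_real t))) \<partial>\<nu>) \<le> ennreal (C * bergman_norm p f)"
proof -
  obtain C where C: "0 < C"
    "\<And>f. f \<in> bergman p \<Longrightarrow> summable (\<lambda>k. norm (taylor_coeff f k) * moment \<nu> k)"
    "\<And>f. f \<in> bergman p \<Longrightarrow> (\<Sum>k. norm (taylor_coeff f k) * moment \<nu> k) \<le> C * bergman_norm p f"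
    using bergman_carleson_embedding[OF p \<nu>] by blast
  have "(\<integral>\<^sup>+t. ennreal (norm (f (of_real t))) \<partial>\<nu>) \<le> ennreal (C * bergman_norm p f)"
    if f: "f \<in> bergman p" for f
  proof -
    have "f holomorphic_on ball 0 1" using f by (simp add: bergman_def)
    note mc = moment_coeff_sums[OF \<nu> this C(2)[OF f], of 0]
    have "(\<integral>\<^sup>+t. ennreal (norm (f (of_real t))) \<partial>\<nu>) = ennreal (LINT t|\<nu>. norm (f (of_real t)))"
      using mc(1) by (intro nn_integral_eq_integral) auto
    also have "\<dots> \<le> ennreal (C * bergman_norm p f)"
      using mc(4) C(3)[OF f] by (intro ennreal_leI) simp
    finally show ?thesis .
  qed
  with C(1) that show ?thesis by blast
qed

text \<open>
  Passes from bounds on nonnegative integrals, which need no integrability, to Bergman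
  membership with a norm bound.
\<close>

lemma bergmanI_nn_integral:
  assumes "0 < p" and holf: "f holomorphic_on ball 0 1" and "0 \<le> B"
    and le: "(\<integral>\<^sup>+z. ennreal (norm (f z) powr p) \<partial>disk_area) \<le> ennreal B"
  shows "f \<in> bergman p" "bergman_norm p f \<le> B powr (1 / p)"
proof -
  have [measurable]: "f \<in> borel_measurable disk_area"
    by (intro continuous_on_imp_measurable_disk_area holomorphic_on_imp_continuous_on holf)
  have int: "integrable disk_area (\<lambda>z. norm (f z) powr p)"
    using le by (intro integrableI_bounded) (auto simp: le_less_trans[OF _ ennreal_less_top])
  with holf show "f \<in> bergman p" by (simp add: bergman_def)
  have "ennreal (LINT z|disk_area. norm (f z) powr p) \<le> ennreal B"
    using le nn_integral_eq_integral[OF int] by simp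
  then have "(LINT z|disk_area. norm (f z) powr p) \<le> B"
    using \<open>0 \<le> B\<close> by (simp add: ennreal_le_iff)
  then show "bergman_norm p f \<le> B powr (1 / p)"
    unfolding bergman_norm_def using \<open>0 < p\<close> by (intro powr_mono2 integral_nonneg_AE) auto
qed

lemma bergman_norm_nonneg: "0 \<le> bergman_norm p f"
  by (simp add: bergman_norm_def)

text \<open>
  The parameter \<open>b\<close> is the order of growth of the kernel integral as
  \<open>t\<close> tends to \<open>1\<close>. Absorbing this growth into the measure leaves a
  \<open>2 / p\<close>-Carleson measure, for which the Carleson embedding is available.
\<close>

lemma hilbert_op_bounded_if_carleson:
  assumes p: "0 < p" "p \<le> 1" and \<alpha>: "-1 < \<alpha>" and \<mu>: "borel_measure_Ico01 \<mu>"
    and b: "0 \<le> b" and car: "carleson (2 / p + b) \<mu>" and K: "0 \<le> K"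
    and kernel: "\<And>t. 0 \<le> t \<Longrightarrow> t < 1 \<Longrightarrow>
      (\<integral>\<^sup>+z. ennreal (norm (1 - of_real t * z) powr (- (\<alpha> + 1))) \<partial>disk_area) \<le> ennreal (K * (1 - t) powr (- b))"
  shows "hilbert_op_bounded \<mu> \<alpha> p 1"
proof -
  have car0: "carleson (2 / p) \<mu>" using b by (intro carleson_mono[OF car]) auto
  define \<nu> where "\<nu> = density \<mu> (\<lambda>t. ennreal ((1 - t) powr (- b)))"
  have \<nu>: "borel_measure_Ico01 \<nu>" "carleson (2 / p) \<nu>"
    using \<mu> p car unfolding \<nu>_def by (auto simp: borel_measure_Ico01_def intro!: carleson_density)
  obtain C where C: "0 < C"
    "\<And>f. f \<in> bergman p \<Longrightarrow> (\<integral>\<^sup>+t. ennreal (norm (f (of_real t))) \<partial>\<nu>) \<le> ennreal (C * bergman_norm p f)"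
    using nn_integral_carleson_embedding[OF p \<nu>] by blast
  obtain C0 where C0: "\<And>f. f \<in> bergman p \<Longrightarrow> summable (\<lambda>k. norm (taylor_coeff f k) * moment \<mu> k)"
    using bergman_carleson_embedding[OF p \<mu> car0] by blast
  have [measurable]: "(\<lambda>u. u) \<in> borel_measurable \<mu>" by (rule Ico01_measurable[OF \<mu>]) simp
  have main: "hilbert_op_defined \<mu> \<alpha> f \<and> hilbert_op \<mu> \<alpha> f \<in> bergman 1 \<and>
      bergman_norm 1 (hilbert_op \<mu> \<alpha> f) \<le> (K * C + 1) * bergman_norm p f" if f: "f \<in> bergman p" for f
  proof -
    have holf: "f holomorphic_on ball 0 1" using f by (simp add: bergman_def)
    note rep = hilbert_op_integral_representation[OF \<mu> car0 holf C0[OF f] \<alpha>]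
    have [measurable]: "(\<lambda>t. f (complex_of_real t)) \<in> borel_measurable \<mu>"
      by (rule Ico01_measurable_holomorphic[OF \<mu> holf])
    have "(\<integral>\<^sup>+z. ennreal (norm (hilbert_op \<mu> \<alpha> f z)) \<partial>disk_area)
      \<le> (\<integral>\<^sup>+t. ennreal (norm (f (of_real t))) *
          (\<integral>\<^sup>+z. ennreal (norm (1 - of_real t * z) powr (- (\<alpha> + 1))) \<partial>disk_area) \<partial>\<mu>)"
      by (rule nn_integral_hilbert_op_le[OF \<mu> car0 holf C0[OF f] \<alpha>])
    also have "\<dots> \<le> (\<integral>\<^sup>+t. ennreal K * (ennreal ((1 - t) powr (- b)) * ennreal (norm (f (of_real t)))) \<partial>\<mu>)"
    proof (rule nn_integral_mono)
      fix t assume "t \<in> space \<mu>"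
      then have t: "0 \<le> t" "t < 1" using Ico01_space[OF \<mu>] by auto
      have "ennreal (norm (f (of_real t))) *
          (\<integral>\<^sup>+z. ennreal (norm (1 - of_real t * z) powr (- (\<alpha> + 1))) \<partial>disk_area)
          \<le> ennreal (norm (f (of_real t))) * ennreal (K * (1 - t) powr (- b))"
        by (intro mult_left_mono kernel t) auto
      also have "\<dots> = ennreal K * (ennreal ((1 - t) powr (- b)) * ennreal (norm (f (of_real t))))"
        using K by (simp add: ennreal_mult mult_ac)
      finally show "ennreal (norm (f (of_real t))) *
          (\<integral>\<^sup>+z. ennreal (norm (1 - of_real t * z) powr (- (\<alpha> + 1))) \<partial>disk_area) \<le> \<dots>" .
    qed
    also have "\<dots> = ennreal K * (\<integral>\<^sup>+t. ennreal ((1 - t) powr (- b)) * ennreal (norm (f (of_real t))) \<partial>\<mu>)"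
      by (rule nn_integral_cmult) measurable
    also have "\<dots> = ennreal K * (\<integral>\<^sup>+t. ennreal (norm (f (of_real t))) \<partial>\<nu>)"
      unfolding \<nu>_def by (subst nn_integral_density) auto
    also have "\<dots> \<le> ennreal K * ennreal (C * bergman_norm p f)"
      by (intro mult_left_mono C(2) f) auto
    also have "\<dots> = ennreal (K * C * bergman_norm p f)"
      using K by (simp add: mult.assoc flip: ennreal_mult')
    finally have le: "(\<integral>\<^sup>+z. ennreal (norm (hilbert_op \<mu> \<alpha> f z) powr 1) \<partial>disk_area)
        \<le> ennreal (K * C * bergman_norm p f)" by simp
    have nn: "0 \<le> K * C * bergman_norm p f"
      using K C(1) bergman_norm_nonneg[of p f] by simp
    note B = bergmanI_nn_integral[OF zero_less_one rep(2) nn le]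
    have "bergman_norm 1 (hilbert_op \<mu> \<alpha> f) \<le> K * C * bergman_norm p f"
      using B(2) nn by simp
    \<comment> \<open>the constant is increased by \<open>1\<close> because it has to be positive even if \<open>K =
      0\<close>\<close>
    also have "\<dots> \<le> (K * C + 1) * bergman_norm p f"
      using bergman_norm_nonneg[of p f] by (intro mult_right_mono) auto
    finally show ?thesis using B(1) rep(1) by blast
  qed
  moreover have "0 < K * C + 1" using K C(1) by (simp add: add_nonneg_pos)
  ultimately show ?thesis unfolding hilbert_op_bounded_def by blast
qed

text \<open>
  With \<open>n p > 2\<close> the kernel integral of exponent \<open>n p\<close> is in the
  supercritical range, where it is governed by the shells at the scale \<open>1 - a\<close>.
\<close>

lemma kernel_power_test_function:
  assumes p: "0 < p" and n: "2 < real n * p"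
  obtains K where "0 < K" "\<And>a. 0 \<le> a \<Longrightarrow> a < 1 \<Longrightarrow>
     (\<lambda>z. 1 / (1 - of_real a * z) ^ n) \<in> bergman p \<and>
     bergman_norm p (\<lambda>z. 1 / (1 - of_real a * z) ^ n) \<le> K * (1 - a) powr (2 / p - real n)"
proof -
  define c where "c = real n * p"
  define L where "L = 2 powr c * 16 / (1 - 2 powr (- c) * 4)"
  have "2 powr (- c) < 2 powr (- 2)" using n by (intro powr_less_mono) (auto simp: c_def)
  then have "0 < L" by (simp add: L_def powr_minus)
  have "(\<lambda>z. 1 / (1 - of_real a * z) ^ n) \<in> bergman p \<and>
     bergman_norm p (\<lambda>z. 1 / (1 - of_real a * z) ^ n) \<le> L powr (1 / p) * (1 - a) powr (2 / p - real n)"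
    if a: "0 \<le> a" "a < 1" for a
  proof -
    let ?f = "\<lambda>z. 1 / (1 - complex_of_real a * z) ^ n"
    have nz: "0 < norm (1 - of_real a * z)" if "norm z < 1" for z :: complex
      using kernel_lower_bound[OF a(1) that] a by linarith
    have hol: "?f holomorphic_on ball 0 1"
      using nz by (intro holomorphic_intros) force
    have "(\<integral>\<^sup>+z. ennreal (norm (?f z) powr p) \<partial>disk_area)
        = (\<integral>\<^sup>+z. ennreal (norm (1 - of_real a * z) powr (- c)) \<partial>disk_area)"
    proof (rule nn_integral_cong)
      fix z assume "z \<in> space disk_area"
      then have pos: "0 < norm (1 - of_real a * z)" using nz by simp
      have "norm (?f z) = norm (1 - of_real a * z) powr (- real n)"
        using pos by (simp only: powr_minus powr_realpow norm_divide norm_power norm_one inverse_eq_divide)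
      then show "ennreal (norm (?f z) powr p) = ennreal (norm (1 - of_real a * z) powr (- c))"
        by (simp add: powr_powr c_def)
    qed
    also have "\<dots> \<le> ennreal (L * (1 - a) powr (2 - c))"
      unfolding L_def using n by (intro disk_kernel_integral_supercritical a) (simp add: c_def)
    finally have le: "(\<integral>\<^sup>+z. ennreal (norm (?f z) powr p) \<partial>disk_area) \<le> ennreal (L * (1 - a) powr (2 - c))" .
    have "0 \<le> L * (1 - a) powr (2 - c)" using \<open>0 < L\<close> by simp
    note B = bergmanI_nn_integral[OF p hol this le]
    have "(2 - c) * (1 / p) = 2 / p - real n" using p by (simp add: c_def field_simps)
    then have "(L * (1 - a) powr (2 - c)) powr (1 / p) = L powr (1 / p) * (1 - a) powr (2 / p - real n)"
      using \<open>0 < L\<close> by (simp only: powr_mult powr_powr powr_ge_zero less_imp_le)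
    with B show ?thesis by simp
  qed
  with \<open>0 < L\<close> show ?thesis using that[of "L powr (1 / p)"] by simp
qed

text \<open>
  Evaluate the image of the test function at \<open>a\<close> itself. For \<open>t \<ge>
  a\<close>, \<open>1 - a t \<le> 2 (1 - a)\<close>, so the integrand is at least \<open>(2 (1 -
  a)) powr (- (n + \<alpha> + 1))\<close> on \<open>[a,1)\<close>; from above, the growth bound
  for \<open>p = 1\<close> is combined with the assumed norm inequality.
\<close>

lemma carleson_if_hilbert_op_bounded:
  assumes p: "0 < p" "p \<le> 1" and \<alpha>: "-1 < \<alpha>" and \<mu>: "borel_measure_Ico01 \<mu>"
    and car: "carleson (2 / p) \<mu>" and bdd: "hilbert_op_bounded \<mu> \<alpha> p 1"
  shows "carleson (2 / p + \<alpha> - 1) \<mu>"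
proof -
  interpret M: finite_measure \<mu> by (rule carleson_finite[OF \<mu> car])
  have sp: "space \<mu> = {0..<1}" by (rule Ico01_space[OF \<mu>])
  define n where "n = nat \<lceil>2 / p\<rceil> + 1"
  have "2 / p < real n" unfolding n_def by linarith
  then have n: "2 < real n * p" using p by (simp add: field_simps)
  obtain K where K: "0 < K" "\<And>a. 0 \<le> a \<Longrightarrow> a < 1 \<Longrightarrow>
     (\<lambda>z. 1 / (1 - of_real a * z) ^ n) \<in> bergman p \<and>
     bergman_norm p (\<lambda>z. 1 / (1 - of_real a * z) ^ n) \<le> K * (1 - a) powr (2 / p - real n)"
    using kernel_power_test_function[OF p(1) n] by blast
  obtain C where C: "0 < C"
    "\<And>f. f \<in> bergman p \<Longrightarrow> hilbert_op \<mu> \<alpha> f \<in> bergman 1"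
    "\<And>f. f \<in> bergman p \<Longrightarrow> bergman_norm 1 (hilbert_op \<mu> \<alpha> f) \<le> C * bergman_norm p f"
    using bdd unfolding hilbert_op_bounded_def by blast
  obtain C0 where C0: "\<And>f. f \<in> bergman p \<Longrightarrow> summable (\<lambda>k. norm (taylor_coeff f k) * moment \<mu> k)"
    using bergman_carleson_embedding[OF p \<mu> car] by blast
  define c where "c = \<alpha> + 1"
  define m where "m = real n + c"
  have "0 < m" using \<alpha> by (simp add: m_def c_def)
  define L where "L = 4 * C * K * 2 powr m"
  have "0 < L" using C(1) K(1) by (simp add: L_def)
  have "emeasure \<mu> {a..<1} \<le> ennreal (L * (1 - a) powr (2 / p + \<alpha> - 1))" if a: "0 \<le> a" "a < 1" for a
  proof -
    define f where "f = (\<lambda>z. 1 / (1 - complex_of_real a * z) ^ n)"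
    define \<delta> where "\<delta> = 1 - a"
    have \<delta>: "0 < \<delta>" using a by (simp add: \<delta>_def)
    have f: "f \<in> bergman p" and fn: "bergman_norm p f \<le> K * \<delta> powr (2 / p - real n)"
      using K(2)[OF a] by (auto simp: f_def \<delta>_def)
    have holf: "f holomorphic_on ball 0 1" using f by (simp add: bergman_def)
    have na: "norm (complex_of_real a) < 1" using a by simp
    note rep = hilbert_op_integral_representation(3,4)[OF \<mu> car holf C0[OF f] \<alpha> na]
    have pos: "0 < 1 - a * t" if "t \<in> {0..<1}" for t
    proof -
      have "a * t \<le> a * 1" using that a by (intro mult_left_mono) auto
      then show ?thesis using a by simp
    qed
    have ker: "f (of_real t) * (1 - of_real t * of_real a) powr of_real (- (\<alpha> + 1))
        = of_real ((1 - a * t) powr (- m))" if "t \<in> {0..<1}" for t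
    proof -
      have "f (of_real t) = of_real ((1 - a * t) powr (- real n))"
        using pos[OF that] by (simp add: f_def powr_minus powr_realpow inverse_eq_divide)
      moreover have "(1 - of_real t * of_real a) powr of_real (- (\<alpha> + 1))
          = complex_of_real ((1 - a * t) powr (- c))"
        using pos[OF that] powr_of_real[of "1 - a * t" "- c"]
        by (simp add: c_def mult.commute)
      ultimately have "f (of_real t) * (1 - of_real t * of_real a) powr of_real (- (\<alpha> + 1))
          = complex_of_real ((1 - a * t) powr (- real n) * (1 - a * t) powr (- c))"
        by (simp only: of_real_mult)
      also have "(1 - a * t) powr (- real n) * (1 - a * t) powr (- c) = (1 - a * t) powr (- m)"
        by (simp add: m_def flip: powr_add)
      finally show ?thesis .
    qed
    have intr: "integrable \<mu> (\<lambda>t. (1 - a * t) powr (- m))"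
    proof -
      have "integrable \<mu> (\<lambda>t. complex_of_real ((1 - a * t) powr (- m)))"
        using rep(1) by (subst Bochner_Integration.integrable_cong[OF refl ker[symmetric]]) (auto simp: sp)
      then show ?thesis by (simp only: complex_of_real_integrable_eq)
    qed
    have val: "hilbert_op \<mu> \<alpha> f (of_real a) = of_real (LINT t|\<mu>. (1 - a * t) powr (- m))"
      unfolding rep(2) integral_complex_of_real[symmetric]
      by (rule Bochner_Integration.integral_cong) (use ker in \<open>auto simp: sp\<close>)
    have Sa: "{a..<1} \<in> sets \<mu>" by (rule Ico01_sets[OF \<mu> a(1)])
    have "(2 * \<delta>) powr (- m) * measure \<mu> {a..<1} = (LINT t|\<mu>. (2 * \<delta>) powr (- m) * indicator {a..<1} t)"
      using Sa by simp
    also have "\<dots> \<le> (LINT t|\<mu>. (1 - a * t) powr (- m))"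
    proof (rule integral_mono[OF _ intr])
      show "integrable \<mu> (\<lambda>t. (2 * \<delta>) powr (- m) * indicator {a..<1} t)"
        using Sa by (intro integrable_mult_right integrable_real_indicator) (auto simp: M.emeasure_eq_measure)
      fix t assume "t \<in> space \<mu>"
      then have t: "t \<in> {0..<1}" by (simp add: sp)
      show "(2 * \<delta>) powr (- m) * indicator {a..<1} t \<le> (1 - a * t) powr (- m)"
      proof (cases "a \<le> t")
        case True
        have "a * a \<le> a * t" using True a by (intro mult_left_mono) auto
        moreover have "0 \<le> (1 - a) * (1 - a)" by simp
        ultimately have "1 - a * t \<le> 2 * \<delta>" unfolding \<delta>_def by (simp add: algebra_simps)
        then have "(2 * \<delta>) powr (- m) \<le> (1 - a * t) powr (- m)"
          using pos[OF t] \<open>0 < m\<close> by (intro powr_mono2') auto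
        then show ?thesis using True t by simp
      qed simp
    qed
    also have "\<dots> \<le> norm (hilbert_op \<mu> \<alpha> f (of_real a))" unfolding val by simp
    finally have "(2 * \<delta>) powr (- m) * measure \<mu> {a..<1} * \<delta> powr 2
        \<le> norm (hilbert_op \<mu> \<alpha> f (of_real a)) * \<delta> powr 2"
      by (intro mult_right_mono) auto
    also have "\<dots> \<le> 4 * bergman_norm 1 (hilbert_op \<mu> \<alpha> f)"
      using bergman_growth[OF zero_less_one order_refl C(2)[OF f] na] a by (simp add: \<delta>_def)
    also have "\<dots> \<le> 4 * (C * (K * \<delta> powr (2 / p - real n)))"
      by (intro mult_left_mono order_trans[OF C(3)[OF f]] mult_left_mono[OF fn]) (use C(1) in auto)
    finally have "measure \<mu> {a..<1} * ((2 * \<delta>) powr (- m) * \<delta> powr 2)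
        \<le> 4 * C * K * \<delta> powr (2 / p - real n)"
      by (simp add: mult_ac)
    also have "\<dots> = L * \<delta> powr (2 / p + \<alpha> - 1) * ((2 * \<delta>) powr (- m) * \<delta> powr 2)"
    proof -
      have "L * \<delta> powr (2 / p + \<alpha> - 1) * ((2 * \<delta>) powr (- m) * \<delta> powr 2)
          = 4 * C * K * (2 powr m * 2 powr (- m)) * (\<delta> powr (2 / p + \<alpha> - 1) * \<delta> powr (- m) * \<delta> powr 2)"
        using \<delta> by (simp add: L_def powr_mult mult_ac)
      also have "2 powr m * 2 powr (- m) = 1" by (simp flip: powr_add)
      also have "\<delta> powr (2 / p + \<alpha> - 1) * \<delta> powr (- m) * \<delta> powr 2 = \<delta> powr (2 / p - real n)"
        unfolding powr_add[symmetric] by (simp add: m_def c_def)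
      finally show ?thesis by simp
    qed
    finally have "measure \<mu> {a..<1} \<le> L * \<delta> powr (2 / p + \<alpha> - 1)"
      by (rule mult_right_le_imp_le) (use \<delta> in simp)
    then show ?thesis unfolding M.emeasure_eq_measure \<delta>_def by (rule ennreal_leI)
  qed
  with \<open>0 < L\<close> show ?thesis unfolding carleson_def by blast
qed

theorem theorem3p2:
  fixes p \<alpha> :: real and \<mu> :: "real measure"
  assumes "0 < p" and "p \<le> 1" and "\<alpha> > -1"
    and "borel_measure_Ico01 \<mu>"
    and "carleson (2 / p) \<mu>"
  shows "(\<alpha> > 1 \<longrightarrow> (hilbert_op_bounded \<mu> \<alpha> p 1 \<longleftrightarrow> carleson (2 / p + \<alpha> - 1) \<mu>)) \<and>
         (-1 < \<alpha> \<and> \<alpha> < 1 \<longrightarrow> (hilbert_op_bounded \<mu> \<alpha> p 1 \<longleftrightarrow> carleson (2 / p) \<mu>))"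
proof (intro conjI impI iffI)
  assume "hilbert_op_bounded \<mu> \<alpha> p 1"
  with assms show "carleson (2 / p + \<alpha> - 1) \<mu>"
    by (intro carleson_if_hilbert_op_bounded)
next
  assume "1 < \<alpha>" and car: "carleson (2 / p + \<alpha> - 1) \<mu>"
  define K where "K = 2 powr (\<alpha> + 1) * 16 / (1 - 2 powr (- (\<alpha> + 1)) * 4)"
  have "2 powr (- (\<alpha> + 1)) < 2 powr (- 2)" using \<open>1 < \<alpha>\<close> by (intro powr_less_mono) auto
  then have "0 \<le> K" by (simp add: K_def powr_minus)
  show "hilbert_op_bounded \<mu> \<alpha> p 1"
  proof (rule hilbert_op_bounded_if_carleson[OF assms(1-4) _ _ \<open>0 \<le> K\<close>])
    show "0 \<le> \<alpha> - 1" using \<open>1 < \<alpha>\<close> by simp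
    show "carleson (2 / p + (\<alpha> - 1)) \<mu>" using car by (simp add: add_diff_eq)
    fix t :: real assume "0 \<le> t" "t < 1"
    then show "(\<integral>\<^sup>+z. ennreal (norm (1 - of_real t * z) powr (- (\<alpha> + 1))) \<partial>disk_area)
        \<le> ennreal (K * (1 - t) powr (- (\<alpha> - 1)))"
      using disk_kernel_integral_supercritical[of "\<alpha> + 1" t] \<open>1 < \<alpha>\<close>
      by (simp add: K_def algebra_simps)
  qed
next
  assume "-1 < \<alpha> \<and> \<alpha> < 1"
  define K where "K = 2 powr (- (\<alpha> + 1)) * (2 powr \<bar>\<alpha> + 1\<bar> * 16 / (1 - 2 powr (\<alpha> + 1) * (1 / 4)))"
  have "2 powr (\<alpha> + 1) < 2 powr 2"
    using \<open>-1 < \<alpha> \<and> \<alpha> < 1\<close> by (intro powr_less_mono) auto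
  then have "0 \<le> K" by (simp add: K_def)
  show "hilbert_op_bounded \<mu> \<alpha> p 1"
  proof (rule hilbert_op_bounded_if_carleson[OF assms(1-4) order_refl _ \<open>0 \<le> K\<close>])
    show "carleson (2 / p + 0) \<mu>" using assms(5) by simp
    fix t :: real assume t: "0 \<le> t" "t < 1"
    have "(\<integral>\<^sup>+z. ennreal (norm (1 - of_real t * z) powr (- (\<alpha> + 1))) \<partial>disk_area) \<le> ennreal K"
      unfolding K_def using \<open>-1 < \<alpha> \<and> \<alpha> < 1\<close> by (intro disk_kernel_integral_subcritical t) auto
    then show "(\<integral>\<^sup>+z. ennreal (norm (1 - of_real t * z) powr (- (\<alpha> + 1))) \<partial>disk_area)
        \<le> ennreal (K * (1 - t) powr (- 0))"
      using t by simp
  qed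
qed (rule assms)

end
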